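(* Let $(G,V,E)$ be a graph with vertex set $V$ and edge set $E$, and let $n \ge 0$. Then the sink configuration space $\mathrm{Conf}_n^{\mathrm{sink}}(G,V)$ is homotopy equivalent to a CW complex of dimension at most $|E|$. If $G$ is a tree, then this CW complex can be taken to be a cubical complex (of dimension at most $|E|$).
   Context: A graph $(G,V,E)$ is a compact connected CW complex $G$ of dimension one together with its set $V$ of 0-cells (vertices) and its set $E$ of 1-cells (edges); loops and multiple edges are allowed. A tree is a graph $(G,V,E)$ with $G$ contractible. The $n$-th sink configuration space is $\mathrm{Conf}_n^{\mathrm{sink}}(G,V)=\{(x_1,\dots,x_n)\in G^n \mid \text{for all } i\neq j:\ x_i\neq x_j \text{ or } x_i=x_j\in V\}$, with the subspace topology from $G^n$. *)

theory Defs
  imports "HOL-Analysis.Analysis"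
begin

section \<open>CW complexes\<close>

definition disc :: "nat \<Rightarrow> (nat \<Rightarrow> real) topology" where
  "disc k = subtopology (Euclidean_space k) {x. (\<Sum>i<k. (x i)\<^sup>2) \<le> 1}"

definition disc_interior :: "nat \<Rightarrow> (nat \<Rightarrow> real) set" where
  "disc_interior k = {x \<in> topspace (disc k). (\<Sum>i<k. (x i)\<^sup>2) < 1}"

definition disc_boundary :: "nat \<Rightarrow> (nat \<Rightarrow> real) set" where
  "disc_boundary k = {x \<in> topspace (disc k). (\<Sum>i<k. (x i)\<^sup>2) = 1}"

text \<open>
  A CW structure on a space \<open>X\<close> is given by the family \<open>K\<close>, where \<open>K k\<close> is the set of the
  open \<open>k\<close>-dimensional cells, as subsets of \<open>X\<close>.
\<close>

definition characteristic_map ::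
    "'a topology \<Rightarrow> (nat \<Rightarrow> 'a set set) \<Rightarrow> nat \<Rightarrow> 'a set \<Rightarrow> ((nat \<Rightarrow> real) \<Rightarrow> 'a) \<Rightarrow> bool" where
  "characteristic_map X K k c \<phi> \<longleftrightarrow>
     continuous_map (disc k) X \<phi> \<and>
     homeomorphic_map (subtopology (disc k) (disc_interior k)) (subtopology X c) \<phi> \<and>
     \<phi> ` disc_boundary k \<subseteq> (\<Union>j<k. \<Union>(K j))"

text \<open>
  The last two conjuncts are closure-finiteness and the weak topology. No finiteness or
  dimension bound is built in.
\<close>

definition cw_complex :: "'a topology \<Rightarrow> (nat \<Rightarrow> 'a set set) \<Rightarrow> bool" where
  "cw_complex X K \<longleftrightarrow>
     Hausdorff_space X \<and>
     (\<Union>k. \<Union>(K k)) = topspace X \<and>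
     disjoint_family_on snd (SIGMA k:UNIV. K k) \<and>
     (\<forall>k. \<forall>c\<in>K k. \<exists>\<phi>. characteristic_map X K k c \<phi>) \<and>
     (\<forall>k. \<forall>c\<in>K k. \<exists>F. finite F \<and> F \<subseteq> (\<Union>j. K j) \<and> X closure_of c \<subseteq> \<Union>F) \<and>
     (\<forall>A. A \<subseteq> topspace X \<longrightarrow>
        (\<forall>k. \<forall>c\<in>K k. closedin (subtopology X (X closure_of c)) (A \<inter> X closure_of c)) \<longrightarrow>
        closedin X A)"

definition cw_dim_le :: "(nat \<Rightarrow> 'a set set) \<Rightarrow> nat \<Rightarrow> bool" where
  "cw_dim_le K d \<longleftrightarrow> (\<forall>k>d. K k = {})"


section \<open>Cubical complexes\<close>

definition unit_cube :: "nat \<Rightarrow> (nat \<Rightarrow> real) topology" where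
  "unit_cube k = subtopology (Euclidean_space k) {x. \<forall>i<k. 0 \<le> x i \<and> x i \<le> 1}"

text \<open>
  A face of the \<open>k\<close>-cube is described by the disjoint sets \<open>A\<close> and \<open>B\<close> of those
  coordinates that are fixed to 0 and to 1, respectively. The cube is a face of itself.
\<close>

definition face_index :: "nat \<Rightarrow> nat set \<Rightarrow> nat set \<Rightarrow> bool" where
  "face_index k A B \<longleftrightarrow> A \<subseteq> {..<k} \<and> B \<subseteq> {..<k} \<and> A \<inter> B = {}"

definition closed_face :: "nat \<Rightarrow> nat set \<Rightarrow> nat set \<Rightarrow> (nat \<Rightarrow> real) set" where
  "closed_face k A B =
     {x \<in> topspace (unit_cube k). (\<forall>i\<in>A. x i = 0) \<and> (\<forall>i\<in>B. x i = 1)}"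

definition open_face :: "nat \<Rightarrow> nat set \<Rightarrow> nat set \<Rightarrow> (nat \<Rightarrow> real) set" where
  "open_face k A B =
     {x \<in> closed_face k A B. \<forall>i\<in>{..<k} - (A \<union> B). 0 < x i \<and> x i < 1}"

definition is_face :: "nat \<Rightarrow> (nat \<Rightarrow> real) set \<Rightarrow> bool" where
  "is_face k T \<longleftrightarrow> (\<exists>A B. face_index k A B \<and> T = closed_face k A B)"

text \<open>
  Isometries are taken with respect to the Euclidean metric. The library's \<^const>\<open>dist\<close> on
  \<^typ>\<open>nat \<Rightarrow> real\<close> is a different metric.
\<close>

definition face_isometry ::
    "nat \<Rightarrow> (nat \<Rightarrow> real) set \<Rightarrow> nat \<Rightarrow> (nat \<Rightarrow> real) set \<Rightarrow> ((nat \<Rightarrow> real) \<Rightarrow> (nat \<Rightarrow> real)) \<Rightarrow> bool"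
  where
  "face_isometry k T l T' h \<longleftrightarrow>
     bij_betw h T T' \<and>
     (\<forall>x\<in>T. \<forall>y\<in>T. L2_set (\<lambda>i. h x i - h y i) {..<l} = L2_set (\<lambda>i. x i - y i) {..<k})"

text \<open>
  A cubical complex in the sense of Bridson and Haefliger (Metric Spaces of Non-Positive
  Curvature, Definition I.7.32), with the quotient topology: a quotient of a disjoint union
  of cubes in which every cube is embedded and two cubes that meet are glued along an
  isometry of a face of one with a face of the other. An element \<open>(k, p)\<close> of \<open>S\<close> is a
  \<open>k\<close>-cube together with its map to the quotient.
\<close>

definition cube_gluing :: "'a topology \<Rightarrow> (nat \<times> ((nat \<Rightarrow> real) \<Rightarrow> 'a)) set \<Rightarrow> bool" where
  "cube_gluing X S \<longleftrightarrow>
     quotient_map (sum_topology (\<lambda>(k, p). unit_cube k) S) X (\<lambda>((k, p), x). p x) \<and>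
     (\<forall>(k, p)\<in>S. inj_on p (topspace (unit_cube k))) \<and>
     (\<forall>(k, p)\<in>S. \<forall>(l, q)\<in>S.
        p ` topspace (unit_cube k) \<inter> q ` topspace (unit_cube l) \<noteq> {} \<longrightarrow>
        (\<exists>T T' h. is_face k T \<and> is_face l T' \<and> face_isometry k T l T' h \<and>
           (\<forall>x\<in>topspace (unit_cube k). \<forall>y\<in>topspace (unit_cube l).
              p x = q y \<longleftrightarrow> x \<in> T \<and> y \<in> T' \<and> y = h x)))"

definition cube_cells :: "(nat \<times> ((nat \<Rightarrow> real) \<Rightarrow> 'a)) set \<Rightarrow> nat \<Rightarrow> 'a set set" where
  "cube_cells S j =
     {p ` open_face k A B | k p A B. (k, p) \<in> S \<and> face_index k A B \<and> k = j + card (A \<union> B)}"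

text \<open>A CW complex is cubical if its cells are the open faces of the cubes of such a gluing.\<close>

definition cubical_complex :: "'a topology \<Rightarrow> (nat \<Rightarrow> 'a set set) \<Rightarrow> bool" where
  "cubical_complex X K \<longleftrightarrow> cw_complex X K \<and> (\<exists>S. cube_gluing X S \<and> K = cube_cells S)"


section \<open>Graphs and sink configuration spaces\<close>

text \<open>
  \<open>V\<close> is a set of points, \<open>E\<close> a set of open 1-cells. The condition \<open>E \<noteq> {}\<close> says that the
  dimension is exactly one. Finiteness of \<open>V\<close> and \<open>E\<close> follows from compactness.
\<close>

definition graph :: "'a topology \<Rightarrow> 'a set \<Rightarrow> 'a set set \<Rightarrow> bool" where
  "graph G V E \<longleftrightarrow>
     cw_complex G (\<lambda>k. if k = 0 then (\<lambda>v. {v}) ` V else if k = 1 then E else {}) \<and>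
     E \<noteq> {} \<and> compact_space G \<and> connected_space G"

definition tree :: "'a topology \<Rightarrow> 'a set \<Rightarrow> 'a set set \<Rightarrow> bool" where
  "tree G V E \<longleftrightarrow> graph G V E \<and> contractible_space G"

text \<open>Points of \<open>G\<^sup>n\<close> are extensional functions on \<open>{..<n}\<close>.\<close>

definition sink_conf :: "nat \<Rightarrow> 'a topology \<Rightarrow> 'a set \<Rightarrow> (nat \<Rightarrow> 'a) topology" where
  "sink_conf n G V =
     subtopology (product_topology (\<lambda>_. G) {..<n})
       {x. \<forall>i<n. \<forall>j<n. i \<noteq> j \<longrightarrow> x i \<noteq> x j \<or> (x i = x j \<and> x i \<in> V)}"

end

theory Submission
  imports Defs
begin

text \<open>
  Let \<open>X\<close> consist of the configurations with at most one point in each open edge. It is the union of the cells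
  \<open>\<sigma> 0 \<times> \<dots> \<times> \<sigma> (n - 1)\<close> of \<open>G\<^sup>n\<close> that use no edge twice. Such a cell has at most \<open>|E|\<close> edge factors, and
  \<open>X\<close> is a finite complex of dimension at most \<open>|E|\<close> (\<open>cw_complex_uncrowded_conf\<close>, \<open>label_dim_le\<close>). It
  lies in the sink configuration space, because points that share a position on \<open>X\<close> share a vertex.

  The sink configuration space deformation retracts to \<open>X\<close> (\<open>homotopy_equivalent_uncrowded\<close>). The points on an edge
  can be driven out by dilating the edge about its midpoint; a point that reaches an end stops there, which is
  allowed as the ends are sinks, and two points never collide in the interior. How far to dilate has to
  depend continuously on the configuration. Measure the distance of a point from the midpoint, scaled
  so that it is 1 at the ends, and let it be 1 for points off the edge. Let \<open>\<rho>\<close> be the second smallest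
  of the \<open>n\<close> distances, or 1 if there are fewer than two points. Dilation by \<open>1 / \<rho>\<close> keeps at most
  one point in the open edge. The number \<open>\<rho>\<close> is continuous; it is positive because two points cannot
  both sit at the midpoint (\<open>second_depth_pos\<close>); and it is 1 on \<open>X\<close>, which therefore remains fixed
  (\<open>second_depth_uncrowded\<close>). Doing this for every edge in turn gives the retraction.

  Each cell of \<open>X\<close> has a chart defined on a cube. Whether these charts form a cubical complex can
  be decided in each factor of \<open>G\<^sup>n\<close> separately: it suffices that every edge has two distinct ends and that distinct
  edges share at most one end (\<open>tree_cells_meet_once\<close>). For a tree this follows from the fact that
  no path outside an edge joins its ends (\<open>tree_no_bypass\<close>): otherwise the map from \<open>G\<close> to the
  circle that collapses the complement of the edge would have degree 1 on a loop, although every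
  loop in \<open>G\<close> is null-homotopic.
\<close>

section \<open>Discs and cubes\<close>

lemma continuous_map_Max_insert:
  fixes f :: "'i \<Rightarrow> 'b \<Rightarrow> real"
  assumes "finite I" "\<And>i. i \<in> I \<Longrightarrow> continuous_map X euclideanreal (f i)"
  shows "continuous_map X euclideanreal (\<lambda>x. Max (insert a ((\<lambda>i. f i x) ` I)))"
  using assms
proof (induction I rule: finite_induct)
  case (insert j I)
  have "Max (insert a ((\<lambda>i. f i x) ` insert j I)) = max (f j x) (Max (insert a ((\<lambda>i. f i x) ` I)))" for x
    using insert.hyps by (simp add: insert_commute[of a] del: Max_insert)
      (simp add: Max_insert del: insert_iff)
  with insert show ?case
    by (simp add: continuous_map_real_max)
qed auto

lemma continuous_map_Min_insert:
  fixes f :: "'i \<Rightarrow> 'b \<Rightarrow> real"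
  assumes "finite I" "\<And>i. i \<in> I \<Longrightarrow> continuous_map X euclideanreal (f i)"
  shows "continuous_map X euclideanreal (\<lambda>x. Min (insert a ((\<lambda>i. f i x) ` I)))"
  using assms
proof (induction I rule: finite_induct)
  case (insert j I)
  have "Min (insert a ((\<lambda>i. f i x) ` insert j I)) = min (f j x) (Min (insert a ((\<lambda>i. f i x) ` I)))" for x
    using insert.hyps by (simp add: insert_commute[of a] del: Min_insert)
      (simp add: Min_insert del: insert_iff)
  with insert show ?case
    by (simp add: continuous_map_real_min)
qed auto

text \<open>
  The maximum norm of the first \<open>k\<close> coordinates, whose unit ball is the cube \<open>[-1, 1]\<^sup>k\<close>.
  The inserted 0 gives the right value for \<open>k = 0\<close>.
\<close>

definition max_norm :: "nat \<Rightarrow> (nat \<Rightarrow> real) \<Rightarrow> real" where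
  "max_norm k x = Max (insert 0 ((\<lambda>i. \<bar>x i\<bar>) ` {..<k}))"

lemma max_norm_nonneg: "0 \<le> max_norm k x"
  by (simp add: max_norm_def)

lemma abs_le_max_norm: "i < k \<Longrightarrow> \<bar>x i\<bar> \<le> max_norm k x"
  by (simp add: max_norm_def)

lemma max_norm_le_iff: "max_norm k x \<le> r \<longleftrightarrow> 0 \<le> r \<and> (\<forall>i<k. \<bar>x i\<bar> \<le> r)"
  by (auto simp: max_norm_def)

lemma max_norm_less_iff: "max_norm k x < r \<longleftrightarrow> 0 < r \<and> (\<forall>i<k. \<bar>x i\<bar> < r)"
  by (auto simp: max_norm_def)

lemma max_norm_cong: "(\<And>i. i < k \<Longrightarrow> x i = y i) \<Longrightarrow> max_norm k x = max_norm k y"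
  unfolding max_norm_def by (intro arg_cong[where f = Max] arg_cong2[where f = insert] image_cong) auto

lemma L2_set_cong_lessThan: "(\<And>i. i < k \<Longrightarrow> x i = y i) \<Longrightarrow> L2_set x {..<k} = L2_set y {..<k}"
  by (rule L2_set_cong) auto

lemma max_norm_scale: "0 < c \<Longrightarrow> max_norm k (\<lambda>i. x i * c) = max_norm k x * c"
proof (rule order_antisym)
  assume c: "0 < c"
  show "max_norm k (\<lambda>i. x i * c) \<le> max_norm k x * c"
    using c by (auto simp: max_norm_le_iff max_norm_nonneg abs_mult intro!: mult_right_mono abs_le_max_norm)
  have "max_norm k x \<le> max_norm k (\<lambda>i. x i * c) / c"
    using c abs_le_max_norm[of _ k "\<lambda>i. x i * c"]
    by (auto simp: max_norm_le_iff max_norm_nonneg abs_mult field_simps)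
  then show "max_norm k x * c \<le> max_norm k (\<lambda>i. x i * c)"
    using c by (simp add: field_simps)
qed

lemma L2_set_scale: "0 < c \<Longrightarrow> L2_set (\<lambda>i. x i * c) A = L2_set x A * c"
  by (simp add: L2_set_left_distrib)

lemma max_norm_le_L2_set: "max_norm k x \<le> L2_set x {..<k}"
proof -
  have "\<bar>x i\<bar> \<le> L2_set x {..<k}" if "i < k" for i
    using member_le_L2_set[of "{..<k}" i "\<lambda>i. \<bar>x i\<bar>"] that by (simp add: L2_set_def)
  then show ?thesis by (simp add: max_norm_le_iff)
qed

lemma topspace_disc: "topspace (disc k) = {x. (\<forall>i\<ge>k. x i = 0) \<and> L2_set x {..<k} \<le> 1}"
  by (auto simp: disc_def topspace_Euclidean_space L2_set_def)

lemma mem_disc_interior: "x \<in> disc_interior k \<longleftrightarrow> x \<in> topspace (disc k) \<and> L2_set x {..<k} < 1"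
  by (auto simp: disc_interior_def L2_set_def)

lemma disc_boundary_eq: "disc_boundary k = topspace (disc k) - disc_interior k"
  by (auto simp: disc_interior_def disc_boundary_def disc_def)

lemma topspace_unit_cube:
  "topspace (unit_cube k) = {x. (\<forall>i\<ge>k. x i = 0) \<and> (\<forall>i<k. 0 \<le> x i \<and> x i \<le> 1)}"
  by (auto simp: unit_cube_def topspace_Euclidean_space)

lemma unit_cube_nonneg_le_1: "x \<in> topspace (unit_cube k) \<Longrightarrow> 0 \<le> x i \<and> x i \<le> 1"
  by (cases "i < k") (auto simp: topspace_unit_cube)

lemma continuous_map_coordinate_subtopology:
  "continuous_map (subtopology (Euclidean_space k) S) euclideanreal (\<lambda>x. x i)"
  unfolding Euclidean_space_def
  by (intro continuous_map_from_subtopology continuous_map_product_projection) simp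

lemma continuous_map_into_Euclidean_subspace:
  assumes "\<And>i. i < k \<Longrightarrow> continuous_map X euclideanreal (\<lambda>x. f x i)"
    and "\<And>x i. x \<in> topspace X \<Longrightarrow> k \<le> i \<Longrightarrow> f x i = 0"
    and "\<And>x. x \<in> topspace X \<Longrightarrow> f x \<in> S"
  shows "continuous_map X (subtopology (Euclidean_space k) S) f"
proof -
  have "continuous_map X (Euclidean_space k) (\<lambda>x i. if i < k then f x i else 0)"
    using assms(1) by (simp add: continuous_map_componentwise_Euclidean_space)
  then have "continuous_map X (Euclidean_space k) f"
    by (rule continuous_map_eq) (auto simp: assms(2) not_less)
  then show ?thesis
    using assms(3) by (auto simp: continuous_map_in_subtopology)
qed

lemma continuous_map_max_norm:
  assumes "\<And>i. i < k \<Longrightarrow> continuous_map X euclideanreal (\<lambda>x. f x i)"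
  shows "continuous_map X euclideanreal (\<lambda>x. max_norm k (f x))"
  unfolding max_norm_def
  by (rule continuous_map_Max_insert) (auto intro!: continuous_map_real_abs assms)

lemma continuous_map_L2_set:
  fixes k :: nat
  assumes "\<And>i. i < k \<Longrightarrow> continuous_map X euclideanreal (\<lambda>x. f x i)"
  shows "continuous_map X euclideanreal (\<lambda>x. L2_set (f x) {..<k})"
proof -
  have "continuous_map X euclideanreal (sqrt \<circ> (\<lambda>x. \<Sum>i<k. (f x i)\<^sup>2))"
  proof (rule continuous_map_compose)
    show "continuous_map X euclideanreal (\<lambda>x. \<Sum>i<k. (f x i)\<^sup>2)"
      by (intro continuous_map_sum continuous_map_real_pow) (auto intro: assms)
    show "continuous_map euclideanreal euclideanreal sqrt"
      by (simp add: continuous_on_real_sqrt)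
  qed
  then show ?thesis by (simp add: L2_set_def o_def)
qed

text \<open>
  Both maps are radial. With \<open>p\<close> the Euclidean and \<open>q\<close> the maximum norm, the vector \<open>x\<close> of the disc
  goes to \<open>x / (1 - p x + q x)\<close> in \<open>[-1, 1]\<^sup>k\<close>, which is then rescaled to \<open>[0, 1]\<^sup>k\<close>. On the unit sphere this
  divides by \<open>q x\<close>, as the usual map \<open>x \<mapsto> (p x / q x) x\<close> does; the advantage over that map is that the
  denominator does not vanish at the origin, so that continuity there needs no argument. As both
  norms are homogeneous, the inverse is \<open>y \<mapsto> y / (1 + p y - q y)\<close>.
\<close>

definition disc_to_cube :: "nat \<Rightarrow> (nat \<Rightarrow> real) \<Rightarrow> nat \<Rightarrow> real" where
  "disc_to_cube k x =
     (\<lambda>i. if i < k then (1 + x i * inverse (1 - L2_set x {..<k} + max_norm k x)) / 2 else 0)"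

definition cube_to_disc :: "nat \<Rightarrow> (nat \<Rightarrow> real) \<Rightarrow> nat \<Rightarrow> real" where
  "cube_to_disc k y =
     (let w = (\<lambda>i. 2 * y i - 1)
      in (\<lambda>i. if i < k then w i * inverse (1 + L2_set w {..<k} - max_norm k w) else 0))"

lemma disc_scale_pos:
  assumes "x \<in> topspace (disc k)"
  shows "0 < 1 - L2_set x {..<k} + max_norm k x"
proof (cases "max_norm k x = 0")
  case True
  then have "x i = 0" if "i < k" for i
    using abs_le_max_norm[OF that, of x] by simp
  then have "L2_set x {..<k} = 0"
    by (simp add: L2_set_eq_0_iff)
  with True show ?thesis by simp
next
  case False
  then show ?thesis
    using assms max_norm_nonneg[of k x] by (simp add: topspace_disc)
qed

lemma cube_scale_pos: "0 < 1 + L2_set w {..<k} - max_norm k w"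
  using max_norm_le_L2_set[of k w] by simp

text \<open>
  Every norm of the image is the norm of \<open>x\<close> divided by \<open>d\<close>, so the image lies in the cube iff
  \<open>max_norm k x \<le> d\<close>, which is \<open>L2_set x {..<k} \<le> 1\<close>; the same holds for the interiors.
\<close>

lemma disc_to_cube_norms:
  assumes x: "x \<in> topspace (disc k)"
  defines "w \<equiv> \<lambda>i. 2 * disc_to_cube k x i - 1" and "d \<equiv> 1 - L2_set x {..<k} + max_norm k x"
  shows "i < k \<Longrightarrow> w i = x i * inverse d"
    and "L2_set w {..<k} = L2_set x {..<k} * inverse d"
    and "max_norm k w = max_norm k x * inverse d"
proof -
  have d: "0 < inverse d"
    using disc_scale_pos[OF x] by (simp add: d_def)
  show w: "w i = x i * inverse d" if "i < k" for i
    using that by (simp add: w_def d_def disc_to_cube_def add_divide_distrib)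
  show "L2_set w {..<k} = L2_set x {..<k} * inverse d"
    by (simp add: L2_set_cong_lessThan[OF w] L2_set_scale[OF d])
  show "max_norm k w = max_norm k x * inverse d"
    by (simp add: max_norm_cong[OF w] max_norm_scale[OF d])
qed

lemma mem_unit_cube_iff_max_norm:
  "y \<in> topspace (unit_cube k) \<longleftrightarrow> (\<forall>i\<ge>k. y i = 0) \<and> max_norm k (\<lambda>i. 2 * y i - 1) \<le> 1"
proof -
  have "\<bar>2 * y i - 1\<bar> \<le> 1 \<longleftrightarrow> 0 \<le> y i \<and> y i \<le> 1" for i
    by linarith
  then show ?thesis by (auto simp: topspace_unit_cube max_norm_le_iff)
qed

lemma mem_open_cube_iff_max_norm:
  "y \<in> open_face k {} {} \<longleftrightarrow> (\<forall>i\<ge>k. y i = 0) \<and> max_norm k (\<lambda>i. 2 * y i - 1) < 1"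
proof -
  have "\<bar>2 * y i - 1\<bar> < 1 \<longleftrightarrow> 0 < y i \<and> y i < 1" for i
    by linarith
  then show ?thesis
    by (auto simp: open_face_def closed_face_def topspace_unit_cube max_norm_less_iff less_imp_le)
qed

lemma disc_to_cube_mem:
  assumes x: "x \<in> topspace (disc k)"
  shows "disc_to_cube k x \<in> topspace (unit_cube k)"
    and "disc_to_cube k x \<in> open_face k {} {} \<longleftrightarrow> x \<in> disc_interior k"
proof -
  have d: "0 < 1 - L2_set x {..<k} + max_norm k x"
    by (rule disc_scale_pos[OF x])
  have z: "\<forall>i\<ge>k. disc_to_cube k x i = 0"
    by (simp add: disc_to_cube_def)
  show "disc_to_cube k x \<in> topspace (unit_cube k)"
    using x d z by (simp add: mem_unit_cube_iff_max_norm disc_to_cube_norms(3)[OF x] topspace_disc field_simps)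
  show "disc_to_cube k x \<in> open_face k {} {} \<longleftrightarrow> x \<in> disc_interior k"
    using x d z by (simp add: mem_open_cube_iff_max_norm disc_to_cube_norms(3)[OF x] mem_disc_interior field_simps)
qed

lemma homeomorphic_maps_disc_cube:
  "homeomorphic_maps (disc k) (unit_cube k) (disc_to_cube k) (cube_to_disc k)"
proof -
  have cd: "continuous_map (disc k) euclideanreal (\<lambda>x. x i)" for i
    unfolding disc_def by (rule continuous_map_coordinate_subtopology)
  have cc: "continuous_map (unit_cube k) euclideanreal (\<lambda>x. x i)" for i
    unfolding unit_cube_def by (rule continuous_map_coordinate_subtopology)
  have 1: "continuous_map (disc k) (unit_cube k) (disc_to_cube k)"
    unfolding unit_cube_def
  proof (rule continuous_map_into_Euclidean_subspace)
    fix i assume "i < k"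
    have "continuous_map (disc k) euclideanreal
        (\<lambda>x. (1 + x i * inverse (1 - L2_set x {..<k} + max_norm k x)) / 2)"
      using disc_scale_pos
      by (intro continuous_intros continuous_map_L2_set continuous_map_max_norm cd
          continuous_map_real_divide continuous_map_real_inverse) force+
    then show "continuous_map (disc k) euclideanreal (\<lambda>x. disc_to_cube k x i)"
      using \<open>i < k\<close> by (simp add: disc_to_cube_def)
  next
    fix x assume "x \<in> topspace (disc k)"
    then show "disc_to_cube k x \<in> {x. \<forall>i<k. 0 \<le> x i \<and> x i \<le> 1}"
      using disc_to_cube_mem(1)[of x k] by (simp add: topspace_unit_cube)
  qed (simp add: disc_to_cube_def)
  have norms: "L2_set (cube_to_disc k y) {..<k} = L2_set w {..<k} * inverse (1 + L2_set w {..<k} - max_norm k w)"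
     "max_norm k (cube_to_disc k y) = max_norm k w * inverse (1 + L2_set w {..<k} - max_norm k w)"
     if "w = (\<lambda>i. 2 * y i - 1)" for w y
  proof -
    have p: "0 < inverse (1 + L2_set w {..<k} - max_norm k w)"
      using cube_scale_pos[where w=w and k=k] by simp
    have e: "cube_to_disc k y i = w i * inverse (1 + L2_set w {..<k} - max_norm k w)" if "i < k" for i
      using that by (simp add: cube_to_disc_def \<open>w = _\<close> Let_def)
    show "L2_set (cube_to_disc k y) {..<k} = L2_set w {..<k} * inverse (1 + L2_set w {..<k} - max_norm k w)"
      by (simp only: L2_set_cong_lessThan[OF e] L2_set_scale[OF p])
    show "max_norm k (cube_to_disc k y) = max_norm k w * inverse (1 + L2_set w {..<k} - max_norm k w)"
      by (simp only: max_norm_cong[OF e] max_norm_scale[OF p])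
  qed
  have 2: "continuous_map (unit_cube k) (disc k) (cube_to_disc k)"
    unfolding disc_def
  proof (rule continuous_map_into_Euclidean_subspace)
    fix i assume "i < k"
    have "continuous_map (unit_cube k) euclideanreal
        (\<lambda>y. (2 * y i - 1) * inverse (1 + L2_set (\<lambda>i. 2 * y i - 1) {..<k} - max_norm k (\<lambda>i. 2 * y i - 1)))"
      by (intro continuous_intros continuous_map_L2_set continuous_map_max_norm cc
          continuous_map_real_inverse less_imp_neq[THEN not_sym] cube_scale_pos)
    then show "continuous_map (unit_cube k) euclideanreal (\<lambda>y. cube_to_disc k y i)"
      using \<open>i < k\<close> by (simp add: cube_to_disc_def Let_def)
  next
    fix y assume y: "y \<in> topspace (unit_cube k)"
    have "L2_set (cube_to_disc k y) {..<k} \<le> 1"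
      using y cube_scale_pos[of "\<lambda>i. 2 * y i - 1" k]
      by (simp add: norms[OF refl] mem_unit_cube_iff_max_norm field_simps)
    then show "cube_to_disc k y \<in> {x. (\<Sum>i<k. (x i)\<^sup>2) \<le> 1}"
      by (simp add: L2_set_def)
  qed (simp add: cube_to_disc_def Let_def)
  have 3: "cube_to_disc k (disc_to_cube k x) = x" if x: "x \<in> topspace (disc k)" for x
  proof
    fix i
    let ?w = "\<lambda>i. 2 * disc_to_cube k x i - 1" and ?d = "1 - L2_set x {..<k} + max_norm k x"
    have d: "0 < ?d" by (rule disc_scale_pos[OF x])
    have e: "1 + L2_set ?w {..<k} - max_norm k ?w = inverse ?d"
      using d by (simp add: disc_to_cube_norms(2,3)[OF x] field_simps)
    show "cube_to_disc k (disc_to_cube k x) i = x i"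
    proof (cases "i < k")
      case True
      then have "cube_to_disc k (disc_to_cube k x) i
          = ?w i * inverse (1 + L2_set ?w {..<k} - max_norm k ?w)"
        by (simp add: cube_to_disc_def Let_def)
      also have "\<dots> = x i"
        unfolding e using d by (simp add: disc_to_cube_norms(1)[OF x True])
      finally show ?thesis .
    next
      case False
      then show ?thesis using x by (simp add: cube_to_disc_def Let_def topspace_disc)
    qed
  qed
  have 4: "disc_to_cube k (cube_to_disc k y) = y" if y: "y \<in> topspace (unit_cube k)" for y
  proof
    fix i
    define w where "w = (\<lambda>i. 2 * y i - 1)"
    define d where "d = 1 + L2_set w {..<k} - max_norm k w"
    let ?x = "cube_to_disc k y"
    have d: "0 < d" unfolding d_def by (rule cube_scale_pos)
    have e: "1 - L2_set ?x {..<k} + max_norm k ?x = inverse d"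
    proof -
      have "1 - L2_set w {..<k} * inverse d + max_norm k w * inverse d = inverse d"
        using d by (simp add: d_def field_simps)
      then show ?thesis
        using norms[OF w_def] by (simp add: d_def)
    qed
    show "disc_to_cube k ?x i = y i"
    proof (cases "i < k")
      case True
      have "?x i = w i * inverse d"
        using True by (simp add: cube_to_disc_def Let_def w_def d_def)
      then have "disc_to_cube k ?x i = (1 + w i) / 2"
        unfolding disc_to_cube_def e using True d by simp
      then show ?thesis by (simp add: w_def)
    next
      case False
      then show ?thesis using y by (simp add: disc_to_cube_def topspace_unit_cube)
    qed
  qed
  show ?thesis
    unfolding homeomorphic_maps_def using 1 2 3 4 by blast
qed

lemma compact_space_unit_cube: "compact_space (unit_cube k)"
proof -
  let ?B = "\<lambda>i. if i < k then {0..1} else {0 :: real}"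
  have "compactin (powertop_real UNIV) (PiE UNIV ?B)"
    by (auto simp: compactin_PiE)
  then have "compact_space (subtopology (powertop_real UNIV) (PiE UNIV ?B))"
    by (rule compact_space_subtopology)
  moreover have "{x. \<forall>i\<ge>k. x i = 0} \<inter> {x. \<forall>i<k. 0 \<le> x i \<and> x i \<le> 1} = PiE UNIV ?B"
  proof (rule set_eqI)
    fix x :: "nat \<Rightarrow> real"
    have "x i \<in> ?B i \<longleftrightarrow> (k \<le> i \<longrightarrow> x i = 0) \<and> (i < k \<longrightarrow> 0 \<le> x i \<and> x i \<le> 1)" for i
      by (cases "i < k") auto
    then show "x \<in> {x. \<forall>i\<ge>k. x i = 0} \<inter> {x. \<forall>i<k. 0 \<le> x i \<and> x i \<le> 1} \<longleftrightarrow> x \<in> PiE UNIV ?B"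
      by (simp add: PiE_UNIV_domain Pi_iff all_conj_distrib)
  qed
  ultimately show ?thesis
    by (simp add: unit_cube_def Euclidean_space_def subtopology_subtopology)
qed

lemma compact_space_disc: "compact_space (disc k)"
  using homeomorphic_compact_space homeomorphic_maps_disc_cube compact_space_unit_cube
  unfolding homeomorphic_space_def by blast

section \<open>Edges of a graph\<close>

text \<open>
  A graph with a parametrisation \<open>\<gamma> e\<close> of each edge by \<open>[0, 1]\<close>. These facts take the
  place of the weak topology and of compactness in all that follows.
\<close>

locale param_graph =
  fixes G :: "'a topology" and V :: "'a set" and E :: "'a set set"
    and \<gamma> :: "'a set \<Rightarrow> real \<Rightarrow> 'a"
  assumes Hausdorff: "Hausdorff_space G"
    and finite_vertices: "finite V"
    and finite_edges: "finite E"
    and topspace_graph: "topspace G = V \<union> \<Union>E"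
    and vertex_notin_edge: "v \<in> V \<Longrightarrow> e \<in> E \<Longrightarrow> v \<notin> e"
    and edges_disjoint: "e \<in> E \<Longrightarrow> e' \<in> E \<Longrightarrow> p \<in> e \<Longrightarrow> p \<in> e' \<Longrightarrow> e = e'"
    and open_edge: "e \<in> E \<Longrightarrow> openin G e"
    and continuous_edge: "e \<in> E \<Longrightarrow> continuous_map (top_of_set {0..1}) G (\<gamma> e)"
    and edge_inj: "e \<in> E \<Longrightarrow> inj_on (\<gamma> e) {0<..<1}"
    and edge_image: "e \<in> E \<Longrightarrow> \<gamma> e ` {0<..<1} = e"
    and edge_ends: "e \<in> E \<Longrightarrow> \<gamma> e 0 \<in> V" "e \<in> E \<Longrightarrow> \<gamma> e 1 \<in> V"

text \<open>
  An infinite \<open>D\<close> would have an accumulation point \<open>x\<close>, but \<open>D - {x}\<close> is closed.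
\<close>

lemma finite_if_all_subsets_closed:
  assumes "compact_space X" "D \<subseteq> topspace X" "\<And>S. S \<subseteq> D \<Longrightarrow> closedin X S"
  shows "finite D"
proof (rule ccontr)
  assume "infinite D"
  then have "topspace X \<inter> X derived_set_of D \<noteq> {}"
    using assms compactin_imp_Bolzano_Weierstrass[of X "topspace X" D] by (simp add: compact_space_def)
  then obtain x where x: "x \<in> X derived_set_of D" by auto
  have "closedin X (D - {x})" using assms(3) by blast
  then have "openin X (topspace X - (D - {x}))" by blast
  moreover have "x \<in> topspace X - (D - {x})" using x by (auto simp: in_derived_set_of)
  moreover have "\<forall>T. x \<in> T \<and> openin X T \<longrightarrow> (\<exists>y. y \<noteq> x \<and> y \<in> D \<and> y \<in> T)"
    using x by (simp add: in_derived_set_of)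
  ultimately have "\<exists>y. y \<noteq> x \<and> y \<in> D \<and> y \<in> topspace X - (D - {x})"
    by (elim allE impE) (rule conjI)
  then show False by blast
qed

definition segment_point :: "real \<Rightarrow> nat \<Rightarrow> real" where
  "segment_point t = (\<lambda>i. if i = 0 then 2 * t - 1 else 0)"

lemma continuous_segment_point: "continuous_map (top_of_set {0..1}) (disc 1) segment_point"
  unfolding disc_def
  by (rule continuous_map_into_Euclidean_subspace)
    (auto simp: segment_point_def abs_square_le_1 intro!: continuous_intros)

lemma disc_1_eq:
  "topspace (disc 1) = segment_point ` {0..1}"
  "disc_interior 1 = segment_point ` {0<..<1}"
proof -
  have x: "x = segment_point ((x 0 + 1) / 2)" if "\<forall>i\<ge>1. x i = 0" for x :: "nat \<Rightarrow> real"
    using that by (auto simp: segment_point_def fun_eq_iff add_divide_distrib)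
  have n: "L2_set x {..<1} = \<bar>x 0\<bar>" for x :: "nat \<Rightarrow> real"
    by (simp add: L2_set_def)
  have td: "x \<in> topspace (disc 1) \<longleftrightarrow> (\<forall>i\<ge>1. x i = 0) \<and> \<bar>x 0\<bar> \<le> 1" for x
    by (simp only: topspace_disc n mem_Collect_eq)
  have ti: "x \<in> disc_interior 1 \<longleftrightarrow> (\<forall>i\<ge>1. x i = 0) \<and> \<bar>x 0\<bar> < 1" for x
    unfolding mem_disc_interior td n by auto
  show "topspace (disc 1) = segment_point ` {0..1}"
  proof (intro equalityI subsetI)
    fix x assume "x \<in> topspace (disc 1)"
    then show "x \<in> segment_point ` {0..1}"
      unfolding td by (intro image_eqI[where f = segment_point, OF x]) auto
  qed (auto simp only: td segment_point_def, auto)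
  show "disc_interior 1 = segment_point ` {0<..<1}"
  proof (intro equalityI subsetI)
    fix x assume "x \<in> disc_interior 1"
    then show "x \<in> segment_point ` {0<..<1}"
      unfolding ti by (intro image_eqI[where f = segment_point, OF x]) auto
  qed (auto simp only: ti segment_point_def, auto)
qed

lemma segment_point_inj: "segment_point s = segment_point t \<longleftrightarrow> s = t"
  by (auto simp: segment_point_def dest: fun_cong[where x = 0])

lemma characteristic_map_1_param:
  assumes "characteristic_map X K 1 e \<phi>" "e \<subseteq> topspace X"
  defines "\<psi> \<equiv> \<phi> \<circ> segment_point"
  shows "continuous_map (top_of_set {0..1}) X \<psi>"
    and "inj_on \<psi> {0<..<1}" and "\<psi> ` {0<..<1} = e"
    and "\<psi> 0 \<in> \<Union>(K 0)" and "\<psi> 1 \<in> \<Union>(K 0)"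
proof -
  have c: "continuous_map (disc 1) X \<phi>"
    and h: "homeomorphic_map (subtopology (disc 1) (disc_interior 1)) (subtopology X e) \<phi>"
    and b: "\<phi> ` disc_boundary 1 \<subseteq> \<Union>(K 0)"
    using assms(1) by (auto simp: characteristic_map_def)
  show "continuous_map (top_of_set {0..1}) X \<psi>"
    unfolding \<psi>_def using continuous_segment_point c by (rule continuous_map_compose)
  have s: "disc_interior 1 \<subseteq> topspace (disc 1)"
    by (auto simp: disc_interior_def)
  have i: "inj_on \<phi> (disc_interior 1)" and im: "\<phi> ` disc_interior 1 = e"
    using homeomorphic_imp_injective_map[OF h] homeomorphic_imp_surjective_map[OF h] s assms(2)
    by (auto simp: Int_absorb1 topspace_subtopology)
  show "inj_on \<psi> {0<..<1}"
    unfolding \<psi>_def using i unfolding disc_1_eq(2)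
    by (intro comp_inj_on) (auto simp: inj_on_def segment_point_inj)
  show "\<psi> ` {0<..<1} = e"
    unfolding \<psi>_def image_comp[symmetric] disc_1_eq(2)[symmetric] by (rule im)
  have "segment_point 0 \<in> disc_boundary 1" "segment_point 1 \<in> disc_boundary 1"
    unfolding disc_boundary_eq disc_1_eq by (auto simp: segment_point_inj)
  then show "\<psi> 0 \<in> \<Union>(K 0)" "\<psi> 1 \<in> \<Union>(K 0)"
    unfolding \<psi>_def using b by auto
qed

text \<open>
  A set that meets every edge in a finite set is closed in the weak topology, because the closure of an
  edge adds only two points to it. Applied to the vertices together with one point from each edge,
  compactness gives finiteness of \<open>V\<close> and \<open>E\<close>. An edge is then open, being the complement of the
  vertices and finitely many compact closed edges.
\<close>

lemma graph_parametrization: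
  assumes "graph G V E"
  shows "\<exists>\<gamma>. param_graph G V E \<gamma>"
proof -
  define K where "K = (\<lambda>k::nat. if k = 0 then (\<lambda>v. {v}) ` V else if k = 1 then E else {})"
  have cw: "cw_complex G K" and comp: "compact_space G"
    using assms by (auto simp: graph_def K_def)
  have K0: "K 0 = (\<lambda>v. {v}) ` V" and K1: "K 1 = E"
    by (auto simp: K_def)
  have H: "Hausdorff_space G" and U: "(\<Union>k. \<Union>(K k)) = topspace G"
    and D: "disjoint_family_on snd (SIGMA k:UNIV. K k)"
    and ch: "\<forall>k. \<forall>c\<in>K k. \<exists>\<phi>. characteristic_map G K k c \<phi>"
    and weak: "\<forall>A. A \<subseteq> topspace G \<longrightarrow>
        (\<forall>k. \<forall>c\<in>K k. closedin (subtopology G (G closure_of c)) (A \<inter> G closure_of c)) \<longrightarrow>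
        closedin G A"
    using cw unfolding cw_complex_def by - (elim conjE, assumption)+
  have top: "topspace G = V \<union> \<Union>E"
  proof -
    have "(\<Union>k. \<Union>(K k)) = \<Union>(K 0) \<union> \<Union>(K 1)"
    proof -
      have "K k \<subseteq> K 0 \<union> K 1" for k by (auto simp: K_def)
      then show ?thesis by blast
    qed
    then show ?thesis using U K0 K1 by simp
  qed
  have vE: "v \<notin> e" if "v \<in> V" "e \<in> E" for v e
    using disjoint_family_onD[OF D, of "(0, {v})" "(1, e)"] that K0 K1 by auto
  have EE: "e = e'" if "e \<in> E" "e' \<in> E" "p \<in> e" "p \<in> e'" for p e e'
    using disjoint_family_onD[OF D, of "(1, e)" "(1, e')"] that K1 by auto
  have "\<exists>\<psi>. continuous_map (top_of_set {0..1}) G \<psi> \<and> inj_on \<psi> {0<..<1::real} \<and> \<psi> ` {0<..<1} = e \<and>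
      \<psi> 0 \<in> V \<and> \<psi> 1 \<in> V" if e: "e \<in> E" for e
  proof -
    obtain \<phi> where "characteristic_map G K 1 e \<phi>" using ch e K1 by metis
    note * = characteristic_map_1_param[OF this]
    have "\<Union>(K 0) = V" "e \<subseteq> topspace G" using e top K0 by auto
    then show ?thesis
      using *[OF \<open>e \<subseteq> topspace G\<close>] by (intro exI[of _ "\<phi> \<circ> segment_point"]) metis
  qed
  then obtain \<gamma> where \<gamma>: "\<And>e. e \<in> E \<Longrightarrow> continuous_map (top_of_set {0..1}) G (\<gamma> e) \<and> inj_on (\<gamma> e) {0<..<1::real} \<and>
      \<gamma> e ` {0<..<1} = e \<and> \<gamma> e 0 \<in> V \<and> \<gamma> e 1 \<in> V"
    by metis
  have cl: "G closure_of e \<subseteq> insert (\<gamma> e 0) (insert (\<gamma> e 1) e)" if e: "e \<in> E" for e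
  proof (rule closure_of_minimal)
    have "{0..1::real} = insert 0 (insert 1 {0<..<1})" by auto
    then have im: "\<gamma> e ` {0..1} = insert (\<gamma> e 0) (insert (\<gamma> e 1) e)"
      using \<gamma>[OF e] by simp
    have "compactin G (\<gamma> e ` {0..1})"
      by (rule image_compactin[of "top_of_set {0..1}"]) (use \<gamma>[OF e] in \<open>auto simp: compactin_subtopology\<close>)
    then show "closedin G (insert (\<gamma> e 0) (insert (\<gamma> e 1) e))"
      using H im compactin_imp_closedin by metis
  qed auto
  have finclosed: "closedin G S" if "S \<subseteq> topspace G" "\<And>e. e \<in> E \<Longrightarrow> finite (S \<inter> e)" for S
  proof (rule weak[rule_format, OF that(1)])
    fix k c assume c: "c \<in> K k"
    have "finite (S \<inter> G closure_of c)"
    proof (cases "c \<in> E")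
      case True
      have "S \<inter> G closure_of c \<subseteq> insert (\<gamma> c 0) (insert (\<gamma> c 1) (S \<inter> c))"
        using cl[OF True] by auto
      then show ?thesis using that(2)[OF True] finite_subset by blast
    next
      case False
      then obtain v where v: "c = {v}" "v \<in> V" using c by (auto simp: K_def split: if_splits)
      have "G closure_of c = {v}"
        using H v top by (simp add: closure_of_closedin closedin_Hausdorff_singleton)
      then show ?thesis by simp
    qed
    then have "closedin G (S \<inter> G closure_of c)"
      using H that(1) by (simp add: closedin_Hausdorff_finite le_infI1)
    then show "closedin (subtopology G (G closure_of c)) (S \<inter> G closure_of c)"
      by (simp add: closedin_subset_topspace)
  qed
  have mid: "\<gamma> e (1/2) \<in> e" if "e \<in> E" for e
  proof -
    have "\<gamma> e (1/2) \<in> \<gamma> e ` {0<..<1}" by (rule imageI) simp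
    then show ?thesis using \<gamma>[OF that] by simp
  qed
  have finD: "finite (V \<union> (\<lambda>e. \<gamma> e (1/2)) ` E)"
  proof (rule finite_if_all_subsets_closed[OF comp])
    show "V \<union> (\<lambda>e. \<gamma> e (1/2)) ` E \<subseteq> topspace G"
      using top mid by auto
    fix S assume S: "S \<subseteq> V \<union> (\<lambda>e. \<gamma> e (1/2)) ` E"
    show "closedin G S"
    proof (rule finclosed)
      show "S \<subseteq> topspace G" using S top mid by blast
      fix e assume e: "e \<in> E"
      have "S \<inter> e \<subseteq> {\<gamma> e (1/2)}" using S vE EE mid e by blast
      then show "finite (S \<inter> e)" by (rule finite_subset) simp
    qed
  qed
  have finE: "finite E"
  proof (rule finite_imageD)
    show "finite ((\<lambda>e. \<gamma> e (1/2)) ` E)" using finD by simp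
    show "inj_on (\<lambda>e. \<gamma> e (1/2)) E" 
    proof (rule inj_onI)
      fix e e' assume "e \<in> E" "e' \<in> E" "\<gamma> e (1/2) = \<gamma> e' (1/2)"
      then show "e = e'" using EE mid[of e] mid[of e'] by auto
    qed
  qed
  have op: "openin G e" if e: "e \<in> E" for e
  proof -
    have rest: "closedin G (V \<union> (\<Union>e'\<in>E - {e}. insert (\<gamma> e' 0) (insert (\<gamma> e' 1) e')))"
    proof (intro closedin_Un closedin_Union)
      show "closedin G V" using H finD top by (simp add: closedin_Hausdorff_finite)
      fix T assume "T \<in> (\<lambda>e'. insert (\<gamma> e' 0) (insert (\<gamma> e' 1) e')) ` (E - {e})"
      then obtain e' where e': "e' \<in> E" "T = insert (\<gamma> e' 0) (insert (\<gamma> e' 1) e')" by auto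
      have "{0..1::real} = insert 0 (insert 1 {0<..<1})" by auto
      then have "T = \<gamma> e' ` {0..1}" using \<gamma>[OF e'(1)] e'(2) by simp
      moreover have "compactin G (\<gamma> e' ` {0..1})"
        by (rule image_compactin[of "top_of_set {0..1}"]) (use \<gamma>[OF e'(1)] in \<open>auto simp: compactin_subtopology\<close>)
      ultimately show "closedin G T" using H compactin_imp_closedin by metis
    qed (use finE in auto)
    have complement: "topspace G - (V \<union> (\<Union>e'\<in>E - {e}. insert (\<gamma> e' 0) (insert (\<gamma> e' 1) e'))) = e"
    proof -
      have "p \<notin> insert (\<gamma> e' 0) (insert (\<gamma> e' 1) e')" if "p \<in> e" "e' \<in> E - {e}" for p e'
        using that \<gamma>[of e'] vE[OF _ e] EE[OF e, of e' p] by auto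
      moreover have "p \<notin> V" if "p \<in> e" for p
        using that vE[OF _ e] by auto
      ultimately show ?thesis
        using top e by auto
    qed
    show ?thesis
      using openin_diff[OF openin_topspace rest] unfolding complement .
  qed
  show ?thesis
  proof (intro exI[of _ \<gamma>] param_graph.intro)
    show "finite V" using finD by simp
    show "v \<notin> e" if "v \<in> V" "e \<in> E" for v e using vE that .
    show "e = e'" if "e \<in> E" "e' \<in> E" "p \<in> e" "p \<in> e'" for e e' p using EE that .
  qed (use H finE top op \<gamma> in blast)+
qed

context param_graph
begin

definition coord :: "'a set \<Rightarrow> 'a \<Rightarrow> real" where
  "coord e = the_inv_into {0<..<1} (\<gamma> e)"

lemma coord_edge: "e \<in> E \<Longrightarrow> 0 < t \<Longrightarrow> t < 1 \<Longrightarrow> coord e (\<gamma> e t) = t"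
  unfolding coord_def by (rule the_inv_into_f_f[OF edge_inj]) auto

lemma edge_coord:
  assumes "e \<in> E" "p \<in> e"
  shows "0 < coord e p" "coord e p < 1" "\<gamma> e (coord e p) = p"
proof -
  obtain t where "0 < t" "t < 1" "p = \<gamma> e t"
    using assms edge_image[OF assms(1)] by force
  then show "0 < coord e p" "coord e p < 1" "\<gamma> e (coord e p) = p"
    using coord_edge[OF assms(1)] by auto
qed

lemma edge_mem_iff:
  assumes "e \<in> E" "0 \<le> t" "t \<le> 1"
  shows "\<gamma> e t \<in> e \<longleftrightarrow> 0 < t \<and> t < 1"
  using assms edge_image[OF assms(1)] edge_ends[OF assms(1)] vertex_notin_edge
  by (metis greaterThanLessThan_iff imageI order_le_less)

lemma edge_in_topspace: "e \<in> E \<Longrightarrow> 0 \<le> t \<Longrightarrow> t \<le> 1 \<Longrightarrow> \<gamma> e t \<in> topspace G"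
  using continuous_map_image_subset_topspace[OF continuous_edge] by force

lemma edge_cases:
  assumes "p \<in> topspace G"
  obtains "p \<in> V" | e where "e \<in> E" "p \<in> e"
  using assms topspace_graph by auto

text \<open>
  \<open>G \<times> Z\<close> is the union of two closed sets, the closed edge times \<open>Z\<close> and the complement of the open edge
  times \<open>Z\<close>. On the first, continuity may be tested after pulling back along \<open>\<gamma> e \<times> id\<close>, which is a closed
  map: \<open>\<gamma> e\<close> is proper, and properness, unlike closedness, survives the product with \<open>Z\<close>.
\<close>

lemma continuous_map_edge_extend:
  assumes e: "e \<in> E"
    and f: "continuous_map (prod_topology (top_of_set {0..1}) Z) Y f"
    and g: "continuous_map (prod_topology G Z) Y g"
    and 0: "\<And>z. z \<in> topspace Z \<Longrightarrow> f (0, z) = g (\<gamma> e 0, z)"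
    and 1: "\<And>z. z \<in> topspace Z \<Longrightarrow> f (1, z) = g (\<gamma> e 1, z)"
  shows "continuous_map (prod_topology G Z) Y (\<lambda>(p, z). if p \<in> e then f (coord e p, z) else g (p, z))"
    (is "continuous_map ?GZ Y ?h")
proof -
  let ?IZ = "prod_topology (top_of_set {0..1::real}) Z"
  let ?\<gamma> = "\<lambda>(t, z). (\<gamma> e t, z)"
  have "proper_map (top_of_set {0..1}) G (\<gamma> e)"
    by (rule continuous_imp_proper_map[OF _ _ continuous_edge[OF e]])
      (use Hausdorff in \<open>auto simp: Hausdorff_imp_kc_space compact_space_subtopology compactin_euclidean_iff\<close>)
  then have "proper_map ?IZ ?GZ ?\<gamma>"
    using proper_map_prod[of "top_of_set {0..1}" Z G Z "\<gamma> e" id] proper_map_id[of Z] by simp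
  then have cm: "closed_map ?IZ ?GZ ?\<gamma>"
    by (rule proper_imp_closed_map)
  show ?thesis
    unfolding continuous_map_closedin
  proof (intro conjI allI impI)
    show "?h \<in> topspace ?GZ \<rightarrow> topspace Y"
    proof
      fix x assume "x \<in> topspace ?GZ"
      then obtain p z where x: "x = (p, z)" "p \<in> topspace G" "z \<in> topspace Z" by auto
      show "?h x \<in> topspace Y"
      proof (cases "p \<in> e")
        case True
        then have "(coord e p, z) \<in> topspace ?IZ" using x edge_coord[OF e True] by auto
        with True x show ?thesis using continuous_map_image_subset_topspace[OF f] by auto
      next
        case False
        then show ?thesis using x continuous_map_image_subset_topspace[OF g] by auto
      qed
    qed
    fix C assume C: "closedin Y C"
    let ?A = "?\<gamma> ` {x \<in> topspace ?IZ. f x \<in> C}"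
    let ?B = "{x \<in> topspace ?GZ. g x \<in> C} \<inter> (topspace G - e) \<times> topspace Z"
    have "closedin ?IZ {x \<in> topspace ?IZ. f x \<in> C}"
      using f C by (rule closedin_continuous_map_preimage)
    then have "closedin ?GZ ?A"
      using cm unfolding closed_map_def by blast
    moreover have "closedin ?GZ ?B"
      using closedin_continuous_map_preimage[OF g C] open_edge[OF e]
      by (intro closedin_Int) (auto simp: closedin_prod_Times_iff)
    moreover have "{x \<in> topspace ?GZ. ?h x \<in> C} = ?A \<union> ?B"
    proof (intro equalityI subsetI)
      fix x assume "x \<in> {x \<in> topspace ?GZ. ?h x \<in> C}"
      then obtain p z where x: "x = (p, z)" "p \<in> topspace G" "z \<in> topspace Z" "?h (p, z) \<in> C"
        by auto
      show "x \<in> ?A \<union> ?B"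
      proof (cases "p \<in> e")
        case True
        then have "x = ?\<gamma> (coord e p, z)" "(coord e p, z) \<in> {x \<in> topspace ?IZ. f x \<in> C}"
          using x edge_coord[OF e True] by auto
        then show ?thesis by blast
      qed (use x in auto)
    next
      fix x assume "x \<in> ?A \<union> ?B"
      then consider t z where "0 \<le> t" "t \<le> 1" "z \<in> topspace Z" "f (t, z) \<in> C" "x = (\<gamma> e t, z)"
        | "x \<in> ?B" by auto
      then show "x \<in> {x \<in> topspace ?GZ. ?h x \<in> C}"
      proof cases
        case 1
        have "?h (\<gamma> e t, z) = f (t, z)"
        proof (cases "0 < t \<and> t < 1")
          case True
          then show ?thesis using edge_mem_iff[OF e] coord_edge[OF e] by simp
        next
          case False
          with 1 have "t = 0 \<or> t = 1" by auto
          then show ?thesis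
            using 0 assms(5) 1(3) edge_mem_iff[OF e, of t] by auto
        qed
        then show ?thesis using 1 edge_in_topspace[OF e] by simp
      qed auto
    qed
    ultimately show "closedin ?GZ {x \<in> topspace ?GZ. ?h x \<in> C}"
      by (simp add: closedin_Un)
  qed
qed

lemma continuous_map_edge_collapse:
  assumes e: "e \<in> E" and f: "continuous_map (top_of_set {0..1}) Y f" and "f 0 = c" "f 1 = c"
  shows "continuous_map G Y (\<lambda>p. if p \<in> e then f (coord e p) else c)"
proof -
  \<comment> \<open>The parameter space of the previous lemma is taken to be a single point.\<close>
  let ?Z = "top_of_set {0 :: real}"
  have c: "c \<in> topspace Y"
    using continuous_map_image_subset_topspace[OF f] assms(3) by force
  have "continuous_map (prod_topology G ?Z) Y
      (\<lambda>(p, z). if p \<in> e then (f \<circ> fst) (coord e p, z) else (\<lambda>_. c) (p, z))"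
  proof (rule continuous_map_edge_extend[OF e])
    show "continuous_map (prod_topology (top_of_set {0..1}) ?Z) Y (f \<circ> fst)"
      using continuous_map_fst f by (rule continuous_map_compose)
  qed (use assms c in auto)
  then have "continuous_map G Y
      ((\<lambda>(p, z). if p \<in> e then (f \<circ> fst) (coord e p, z) else (\<lambda>_. c) (p, z)) \<circ> (\<lambda>p. (p, 0 :: real)))"
    by (rule continuous_map_compose[rotated]) (auto simp: continuous_map_pairwise o_def)
  then show ?thesis by (simp add: o_def cong: if_cong)
qed

end

section \<open>The deformation retraction\<close>

text \<open>
  Dilation of \<open>[0, 1]\<close> about its midpoint by the factor \<open>1 / \<rho>\<close>, cut off at the ends: the middle part of
  relative length \<open>\<rho>\<close> is expanded to everything, the rest goes to the ends.
\<close>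

definition stretch :: "real \<Rightarrow> real \<Rightarrow> real" where
  "stretch \<rho> t = max 0 (min 1 (1/2 + (t - 1/2) / \<rho>))"

lemma stretch_bounds: "0 \<le> stretch \<rho> t" "stretch \<rho> t \<le> 1"
  by (auto simp: stretch_def)

lemma stretch_1: "0 \<le> t \<Longrightarrow> t \<le> 1 \<Longrightarrow> stretch 1 t = t"
  by (auto simp: stretch_def)

lemma stretch_ends:
  assumes "0 < \<rho>" "\<rho> \<le> 1"
  shows "stretch \<rho> 0 = 0" "stretch \<rho> 1 = 1"
  using assms by (auto simp: stretch_def field_simps)

lemma stretch_interior_iff: "0 < \<rho> \<Longrightarrow> 0 < stretch \<rho> t \<and> stretch \<rho> t < 1 \<longleftrightarrow> \<bar>2 * t - 1\<bar> < \<rho>"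
proof -
  assume \<rho>: "0 < \<rho>"
  have "0 < stretch \<rho> t \<and> stretch \<rho> t < 1 \<longleftrightarrow> 0 < 1/2 + (t - 1/2) / \<rho> \<and> 1/2 + (t - 1/2) / \<rho> < 1"
    by (auto simp: stretch_def)
  also have "\<dots> \<longleftrightarrow> \<bar>2 * t - 1\<bar> < \<rho>"
    using \<rho> by (auto simp: field_simps abs_less_iff)
  finally show ?thesis .
qed

lemma stretch_inj:
  assumes "0 < \<rho>" "0 < stretch \<rho> t" "stretch \<rho> t < 1" "stretch \<rho> t = stretch \<rho> s"
  shows "t = s"
proof -
  have "1/2 + (t - 1/2) / \<rho> = 1/2 + (s - 1/2) / \<rho>"
    using assms by (auto simp: stretch_def max_def min_def split: if_splits)
  then show ?thesis using assms(1) by simp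
qed

context param_graph
begin

definition push :: "'a set \<Rightarrow> 'a \<times> real \<Rightarrow> 'a" where
  "push e = (\<lambda>(p, \<rho>). if p \<in> e then \<gamma> e (stretch \<rho> (coord e p)) else p)"

lemma push_1: "e \<in> E \<Longrightarrow> push e (p, 1) = p"
  using edge_coord[of e p] by (auto simp: push_def stretch_1)

lemma continuous_push:
  assumes e: "e \<in> E"
  shows "continuous_map (prod_topology G (top_of_set {0<..1})) G (push e)"
proof -
  let ?Z = "top_of_set {0<..1::real}"
  let ?IZ = "prod_topology (top_of_set {0..1::real}) ?Z"
  have "continuous_map ?IZ euclideanreal (\<lambda>x. 1/2 + (fst x - 1/2) / snd x)"
    by (auto simp: prod_topology_subtopology_eu split_beta intro!: continuous_intros)
  then have "continuous_map ?IZ euclideanreal (\<lambda>x. stretch (snd x) (fst x))"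
    unfolding stretch_def by (intro continuous_map_real_max continuous_map_real_min) auto
  then have "continuous_map ?IZ (top_of_set {0..1}) (\<lambda>x. stretch (snd x) (fst x))"
    by (auto simp: continuous_map_in_subtopology stretch_bounds)
  then have f: "continuous_map ?IZ G (\<gamma> e \<circ> (\<lambda>x. stretch (snd x) (fst x)))"
    using continuous_edge[OF e] by (rule continuous_map_compose)
  have "continuous_map (prod_topology G ?Z) G
    (\<lambda>(p, z). if p \<in> e then (\<gamma> e \<circ> (\<lambda>x. stretch (snd x) (fst x))) (coord e p, z) else fst (p, z))"
    by (rule continuous_map_edge_extend[OF e f continuous_map_fst]) (auto simp: stretch_ends)
  then show ?thesis by (simp add: push_def o_def cong: if_cong)
qed

lemma push_mem_edge:
  assumes "e \<in> E" "e' \<in> E" "push e (p, \<rho>) \<in> e'"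
  shows "p \<in> e'"
proof (cases "p \<in> e")
  case True
  then have "\<gamma> e (stretch \<rho> (coord e p)) \<in> e'"
    using assms(3) by (simp add: push_def)
  moreover have "\<gamma> e (stretch \<rho> (coord e p)) \<in> V \<union> e"
    using edge_ends[OF assms(1)] edge_image[OF assms(1)] stretch_bounds[of \<rho> "coord e p"]
    by (metis UnCI greaterThanLessThan_iff imageI order_le_less)
  ultimately show ?thesis
    using True assms vertex_notin_edge edges_disjoint by blast
qed (use assms in \<open>simp add: push_def\<close>)

text \<open>
  This keeps the deformation inside the sink configuration space. It holds because stretching is injective
  where its values lie strictly between 0 and 1.
\<close>

lemma push_inj_on_edges:
  assumes e: "e \<in> E" and e': "e' \<in> E" and \<rho>: "0 < \<rho>"
    and "push e (p, \<rho>) = push e (q, \<rho>)" "push e (p, \<rho>) \<in> e'"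
  shows "p = q"
proof -
  have pq: "p \<in> e'" "q \<in> e'"
    using push_mem_edge[OF e e'] assms(4,5) by metis+
  show ?thesis
  proof (cases "e = e'")
    case True
    then have p: "p \<in> e" and q: "q \<in> e" using pq by auto
    let ?s = "stretch \<rho> (coord e p)" and ?t = "stretch \<rho> (coord e q)"
    have "\<gamma> e ?s = \<gamma> e ?t" "\<gamma> e ?s \<in> e"
      using assms(4,5) p q True by (auto simp: push_def)
    then have "0 < ?s" "?s < 1" "0 < ?t" "?t < 1" "?s = ?t"
      using edge_mem_iff[OF e] stretch_bounds coord_edge[OF e] by metis+
    then have "coord e p = coord e q"
      using stretch_inj[OF \<rho>] by blast
    then show ?thesis using edge_coord(3)[OF e] p q by metis
  next
    case False
    then have "p \<notin> e" "q \<notin> e" using pq edges_disjoint e e' by blast+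
    then show ?thesis using assms(4) by (simp add: push_def)
  qed
qed

text \<open>
  The distance from the midpoint of \<open>e\<close>, scaled to be 1 at both ends. The value 1 for points off the
  edge makes the function continuous on the whole graph, so that nothing special happens when
  a point enters or leaves the edge.
\<close>

definition depth :: "'a set \<Rightarrow> 'a \<Rightarrow> real" where
  "depth e p = (if p \<in> e then \<bar>2 * coord e p - 1\<bar> else 1)"

lemma continuous_depth: "e \<in> E \<Longrightarrow> continuous_map G euclideanreal (depth e)"
  using continuous_map_edge_collapse[of e euclideanreal "\<lambda>t. \<bar>2 * t - 1\<bar>" 1]
  unfolding depth_def by (force intro!: continuous_intros)

lemma depth_nonneg: "0 \<le> depth e p"
  by (simp add: depth_def)

lemma depth_eq_0: "e \<in> E \<Longrightarrow> depth e p = 0 \<Longrightarrow> p = \<gamma> e (1/2) \<and> p \<in> e"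
proof -
  assume e: "e \<in> E" and "depth e p = 0"
  then have p: "p \<in> e" and "coord e p = 1/2" by (auto simp: depth_def split: if_splits)
  then show ?thesis using edge_coord(3)[OF e p] by metis
qed

lemma push_mem_same_edge_iff:
  assumes "e \<in> E" "0 < \<rho>" "\<rho> \<le> 1"
  shows "push e (p, \<rho>) \<in> e \<longleftrightarrow> depth e p < \<rho>"
  using assms edge_mem_iff[OF assms(1) stretch_bounds, of \<rho> "coord e p"]
    stretch_interior_iff[of \<rho> "coord e p"]
  by (auto simp: push_def depth_def)

text \<open>
  The second smallest of the depths of the points \<open>x 0, \<dots>, x (n - 1)\<close>, written as a minimum over pairs to make
  its continuity evident, and 1 if there are fewer than two points. It serves as the number \<open>\<rho>\<close> by
  which the edge is stretched: fewer than two points have depth less than \<open>\<rho>\<close>, so at most one point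
  stays in the open edge.
\<close>

definition second_depth :: "nat \<Rightarrow> 'a set \<Rightarrow> (nat \<Rightarrow> 'a) \<Rightarrow> real" where
  "second_depth n e x =
     Min (insert 1 ((\<lambda>q. max (depth e (x (fst q))) (depth e (x (snd q)))) ` {(i, j). i < j \<and> j < n}))"

lemma finite_ordered_pairs: "finite {(i, j). i < j \<and> j < (n::nat)}"
  by (rule finite_subset[of _ "{..<n} \<times> {..<n}"]) auto

lemma second_depth_le_1: "second_depth n e x \<le> 1"
  by (simp add: second_depth_def finite_ordered_pairs)

lemma second_depth_le:
  assumes "i < n" "j < n" "i \<noteq> j"
  shows "second_depth n e x \<le> max (depth e (x i)) (depth e (x j))"
proof -
  have *: "second_depth n e x \<le> max (depth e (x i)) (depth e (x j))" if "i < j" "j < n" for i j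
    unfolding second_depth_def
    by (rule Min_le) (use that in \<open>force simp: finite_ordered_pairs\<close>)+
  show ?thesis
    using *[of i j] *[of j i] assms by (metis linorder_neqE_nat max.commute)
qed

lemma less_second_depth_iff:
  "r < second_depth n e x \<longleftrightarrow> r < 1 \<and> (\<forall>j<n. \<forall>i<j. r < max (depth e (x i)) (depth e (x j)))"
  unfolding second_depth_def by (subst Min_gr_iff) (auto simp: finite_ordered_pairs)

text \<open>
  The sink configuration space, with its condition stated edge by edge: collisions in open edges are
  forbidden. In this form the condition can be followed through a push along a single edge.
\<close>

definition sink_configs :: "nat \<Rightarrow> (nat \<Rightarrow> 'a) set" where
  "sink_configs n = {x \<in> PiE {..<n} (\<lambda>_. topspace G).
     \<forall>e\<in>E. \<forall>i<n. \<forall>j<n. x i \<in> e \<longrightarrow> x i = x j \<longrightarrow> i = j}"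

lemma sink_configsD:
  "x \<in> sink_configs n \<Longrightarrow> e \<in> E \<Longrightarrow> i < n \<Longrightarrow> j < n \<Longrightarrow> x i \<in> e \<Longrightarrow> x i = x j \<Longrightarrow> i = j"
  unfolding sink_configs_def by blast

lemma topspace_sink_conf: "topspace (sink_conf n G V) = sink_configs n"
proof -
  have pair: "(i \<noteq> j \<longrightarrow> x i \<noteq> x j \<or> (x i = x j \<and> x i \<in> V)) \<longleftrightarrow> (\<forall>e\<in>E. x i \<in> e \<longrightarrow> x i = x j \<longrightarrow> i = j)"
    if x: "x \<in> PiE {..<n} (\<lambda>_. topspace G)" and i: "i < n" for x i j
  proof -
    have "x i \<in> topspace G" using x i by auto
    then show ?thesis using vertex_notin_edge[of "x i"] by (cases rule: edge_cases) auto
  qed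
  have *: "(\<forall>i<n. \<forall>j<n. i \<noteq> j \<longrightarrow> x i \<noteq> x j \<or> (x i = x j \<and> x i \<in> V)) \<longleftrightarrow>
      (\<forall>e\<in>E. \<forall>i<n. \<forall>j<n. x i \<in> e \<longrightarrow> x i = x j \<longrightarrow> i = j)"
    if "x \<in> PiE {..<n} (\<lambda>_. topspace G)" for x
  proof -
    have "(\<forall>i<n. \<forall>j<n. i \<noteq> j \<longrightarrow> x i \<noteq> x j \<or> (x i = x j \<and> x i \<in> V)) \<longleftrightarrow>
        (\<forall>i<n. \<forall>j<n. \<forall>e\<in>E. x i \<in> e \<longrightarrow> x i = x j \<longrightarrow> i = j)"
      by (intro all_cong pair that)
    also have "\<dots> \<longleftrightarrow> (\<forall>e\<in>E. \<forall>i<n. \<forall>j<n. x i \<in> e \<longrightarrow> x i = x j \<longrightarrow> i = j)"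
      by (safe; metis)
    finally show ?thesis .
  qed
  show ?thesis
    unfolding sink_conf_def sink_configs_def topspace_subtopology topspace_product_topology
    by (rule set_eqI) (unfold Int_iff mem_Collect_eq, rule conj_cong[OF refl *])
qed

lemma sink_conf_eq: "sink_conf n G V = subtopology (product_topology (\<lambda>_. G) {..<n}) (sink_configs n)"
  using subtopology_restrict[symmetric] topspace_sink_conf[of n]
  unfolding sink_conf_def topspace_subtopology by (rule trans[OF _ arg_cong])

text \<open>
  The configurations with at most one point in each open edge. They form the subcomplex of \<open>G\<^sup>n\<close>
  to which the sink configuration space is retracted.
\<close>

definition uncrowded :: "nat \<Rightarrow> (nat \<Rightarrow> 'a) set" where
  "uncrowded n = {x \<in> PiE {..<n} (\<lambda>_. topspace G).
     \<forall>e\<in>E. \<forall>i<n. \<forall>j<n. x i \<in> e \<longrightarrow> x j \<in> e \<longrightarrow> i = j}"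

lemma uncrowdedD:
  "x \<in> uncrowded n \<Longrightarrow> e \<in> E \<Longrightarrow> i < n \<Longrightarrow> j < n \<Longrightarrow> x i \<in> e \<Longrightarrow> x j \<in> e \<Longrightarrow> i = j"
  unfolding uncrowded_def by blast

lemma uncrowded_subset_sink_configs: "uncrowded n \<subseteq> sink_configs n"
  by (auto simp: uncrowded_def sink_configs_def)

text \<open>
  Two points of depth 0 would both sit at the midpoint of \<open>e\<close>, which is not a sink.
\<close>

lemma second_depth_pos:
  assumes "e \<in> E" "x \<in> sink_configs n"
  shows "0 < second_depth n e x"
  unfolding less_second_depth_iff
proof (intro conjI allI impI)
  fix j i assume "j < n" "i < j"
  show "0 < max (depth e (x i)) (depth e (x j))"
  proof (rule ccontr)
    assume "\<not> 0 < max (depth e (x i)) (depth e (x j))"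
    then have "depth e (x i) = 0" "depth e (x j) = 0"
      using depth_nonneg[of e "x i"] depth_nonneg[of e "x j"] by auto
    then have "x i \<in> e" "x i = x j" using depth_eq_0[OF assms(1)] by metis+
    then show False
      using sink_configsD[OF assms(2,1), of i j] \<open>j < n\<close> \<open>i < j\<close> by simp
  qed
qed simp

text \<open>
  Of any two points, one is off the edge and has depth 1. Hence the retraction does not move configurations
  that are already uncrowded.
\<close>

lemma second_depth_uncrowded:
  assumes "e \<in> E" "x \<in> uncrowded n"
  shows "second_depth n e x = 1"
proof (rule antisym[OF second_depth_le_1], rule ccontr)
  assume "\<not> 1 \<le> second_depth n e x"
  moreover have "1 \<le> max (depth e (x i)) (depth e (x j))" if "j < n" "i < j" for i j
  proof -
    have "x i \<notin> e \<or> x j \<notin> e" using uncrowdedD[OF assms(2,1), of i j] that by auto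
    then show ?thesis by (auto simp: depth_def)
  qed
  ultimately show False
    unfolding second_depth_def by (subst (asm) Min_ge_iff) (auto simp: finite_ordered_pairs)
qed

lemma continuous_sink_coordinate: "i < n \<Longrightarrow> continuous_map (sink_conf n G V) G (\<lambda>x. x i)"
  unfolding sink_conf_def
  by (intro continuous_map_from_subtopology continuous_map_product_projection) simp

lemma continuous_second_depth:
  assumes "e \<in> E"
  shows "continuous_map (sink_conf n G V) euclideanreal (second_depth n e)"
proof -
  have "continuous_map (sink_conf n G V) euclideanreal (depth e \<circ> (\<lambda>x. x i))" if "i < n" for i
    using continuous_sink_coordinate[OF that] continuous_depth[OF assms] by (rule continuous_map_compose)
  then show ?thesis
    unfolding second_depth_def
    by (intro continuous_map_Min_insert finite_ordered_pairs)
      (auto simp: o_def intro!: continuous_map_real_max)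
qed

text \<open>
  The deformation at time \<open>s\<close>; the stretching parameter runs linearly from 1, where nothing moves, to the second
  smallest depth.
\<close>

definition spread :: "nat \<Rightarrow> 'a set \<Rightarrow> real \<times> (nat \<Rightarrow> 'a) \<Rightarrow> nat \<Rightarrow> 'a" where
  "spread n e = (\<lambda>(s, x). \<lambda>i\<in>{..<n}. push e (x i, 1 - s + s * second_depth n e x))"

lemma spread_parameter:
  assumes "e \<in> E" "x \<in> sink_configs n" "0 \<le> s" "s \<le> 1"
  shows "0 < 1 - s + s * second_depth n e x" "1 - s + s * second_depth n e x \<le> 1"
proof -
  let ?d = "second_depth n e x"
  have d: "0 < ?d" "?d \<le> 1" by (rule second_depth_pos[OF assms(1,2)], rule second_depth_le_1)
  show "0 < 1 - s + s * ?d"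
  proof (cases "s = 1")
    case False
    then show ?thesis using assms d by (intro add_pos_nonneg) auto
  qed (use d in auto)
  have "s * ?d \<le> s * 1" using assms d by (intro mult_left_mono) auto
  then show "1 - s + s * ?d \<le> 1" by simp
qed

lemma continuous_spread:
  assumes e: "e \<in> E"
  shows "continuous_map (prod_topology (top_of_set {0..1}) (sink_conf n G V)) (sink_conf n G V) (spread n e)"
    (is "continuous_map ?D ?C _")
proof -
  have snd: "continuous_map ?D ?C snd" and fst: "continuous_map ?D (top_of_set {0..1}) fst"
    by (rule continuous_map_snd, rule continuous_map_fst)
  have fst': "continuous_map ?D euclideanreal fst"
    using fst by (simp add: continuous_map_in_subtopology)
  have "continuous_map ?D euclideanreal (second_depth n e \<circ> snd)"
    using snd continuous_second_depth[OF e] by (rule continuous_map_compose)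
  then have "continuous_map ?D euclideanreal (\<lambda>y. 1 - fst y + fst y * second_depth n e (snd y))"
    unfolding o_def by (intro continuous_intros fst')
  then have r: "continuous_map ?D (top_of_set {0<..1}) (\<lambda>y. 1 - fst y + fst y * second_depth n e (snd y))"
    using spread_parameter[OF e] by (auto simp: continuous_map_in_subtopology topspace_sink_conf)
  have "continuous_map ?D G (\<lambda>y. push e (snd y i, 1 - fst y + fst y * second_depth n e (snd y)))"
    if "i < n" for i
  proof -
    have "continuous_map ?D G ((\<lambda>x. x i) \<circ> snd)"
      using snd continuous_sink_coordinate[OF that] by (rule continuous_map_compose)
    then have "continuous_map ?D (prod_topology G (top_of_set {0<..1}))
        (\<lambda>y. (snd y i, 1 - fst y + fst y * second_depth n e (snd y)))"
      using r by (simp add: continuous_map_pairwise o_def)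
    from continuous_map_compose[OF this continuous_push[OF e]] show ?thesis
      by (simp add: o_def)
  qed
  then have c: "continuous_map ?D (product_topology (\<lambda>_. G) {..<n}) (spread n e)"
    unfolding continuous_map_componentwise by (auto simp: spread_def split_beta)
  have "spread n e y \<in> sink_configs n" if y: "y \<in> topspace ?D" for y
  proof -
    obtain s x where sx: "y = (s, x)" "0 \<le> s" "s \<le> 1" "x \<in> sink_configs n"
      using y by (auto simp: topspace_sink_conf)
    have "spread n e y \<in> PiE {..<n} (\<lambda>_. topspace G)"
      using continuous_map_image_subset_topspace[OF c] y by auto
    moreover have "i = j" if "e' \<in> E" "i < n" "j < n" "spread n e y i \<in> e'" "spread n e y i = spread n e y j" for e' i j
    proof -
      let ?\<rho> = "1 - s + s * second_depth n e x"
      have "push e (x i, ?\<rho>) = push e (x j, ?\<rho>)" "push e (x i, ?\<rho>) \<in> e'"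
        using that sx by (auto simp: spread_def)
      then have "x i = x j" "x i \<in> e'"
        using push_inj_on_edges[OF e that(1) spread_parameter(1)[OF e sx(4,2,3)]]
          push_mem_edge[OF e that(1)] by metis+
      then show ?thesis using sx(4) that by (auto simp: sink_configs_def)
    qed
    ultimately show ?thesis unfolding sink_configs_def by blast
  qed
  then show ?thesis
    using c by (subst (2) sink_conf_eq) (simp add: continuous_map_in_subtopology Pi_iff image_subset_iff)
qed

text \<open>
  The edges are cleared one after the other. An edge that has been cleared stays so, because a point
  that is in an open edge after a push was in it before.
\<close>

lemma retraction_over_edges:
  assumes "A \<subseteq> E"
  shows "\<exists>r. homotopic_with (\<lambda>x. True) (sink_conf n G V) (sink_conf n G V) id r \<and>
           (\<forall>x\<in>uncrowded n. r x = x) \<and>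
           (\<forall>x\<in>sink_configs n. \<forall>e\<in>A. \<forall>i<n. \<forall>j<n. r x i \<in> e \<longrightarrow> r x j \<in> e \<longrightarrow> i = j)"
    (is "\<exists>r. homotopic_with _ ?C ?C id r \<and> _")
  using finite_subset[OF assms finite_edges] assms
proof (induction A rule: finite_induct)
  case empty
  show ?case by (intro exI[of _ id]) auto
next
  case (insert e A)
  then obtain r where r: "homotopic_with (\<lambda>x. True) ?C ?C id r" "\<forall>x\<in>uncrowded n. r x = x"
    "\<forall>x\<in>sink_configs n. \<forall>e\<in>A. \<forall>i<n. \<forall>j<n. r x i \<in> e \<longrightarrow> r x j \<in> e \<longrightarrow> i = j"
    by (meson insert_subset)
  have e: "e \<in> E" using insert by auto
  have r_sink_configs: "r x \<in> sink_configs n" if "x \<in> sink_configs n" for x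
    using homotopic_with_imp_continuous_maps[OF r(1)] that
    by (auto simp: continuous_map_def topspace_sink_conf)
  define h where "h = (\<lambda>x. spread n e (1, x))"
  have "homotopic_with (\<lambda>x. True) ?C ?C id h"
  proof -
    have "spread n e (0, x) = id x" if "x \<in> topspace ?C" for x
    proof -
      have "x \<in> extensional {..<n}" using that by (auto simp: topspace_sink_conf sink_configs_def PiE_iff)
      then show ?thesis
        by (auto simp: spread_def push_1[OF e] extensional_def fun_eq_iff)
    qed
    moreover have "homotopic_with (\<lambda>x. True) ?C ?C (\<lambda>x. spread n e (0, x)) h"
      unfolding homotopic_with_def h_def
      by (rule exI[where x = "spread n e"]) (simp add: continuous_spread[OF e])
    ultimately show ?thesis
      by (elim homotopic_with_eq) simp_all
  qed
  then have "homotopic_with (\<lambda>x. True) ?C ?C (id \<circ> r) (h \<circ> r)"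
    by (rule homotopic_with_compose_continuous_map_right)
      (use homotopic_with_imp_continuous_maps[OF r(1)] in simp_all)
  then have 1: "homotopic_with (\<lambda>x. True) ?C ?C id (h \<circ> r)"
    using homotopic_with_trans[OF r(1)] by simp
  have 2: "(h \<circ> r) x = x" if x: "x \<in> uncrowded n" for x
  proof -
    have "x \<in> extensional {..<n}" using x by (auto simp: uncrowded_def PiE_iff)
    moreover have rx: "r x = x" using r(2) x by blast
    ultimately have "spread n e (1, x) = x"
      by (auto simp: spread_def second_depth_uncrowded[OF e x] push_1[OF e] extensional_def fun_eq_iff)
    then show ?thesis using rx by (simp add: h_def)
  qed
  have 3: "i = j"
    if x: "x \<in> sink_configs n" and e': "e' \<in> insert e A" and i: "i < n" and j: "j < n"
      and m: "(h \<circ> r) x i \<in> e'" "(h \<circ> r) x j \<in> e'" for x e' i j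
  proof -
    let ?\<rho> = "second_depth n e (r x)"
    have m': "push e (r x i, ?\<rho>) \<in> e'" "push e (r x j, ?\<rho>) \<in> e'"
      using m i j by (auto simp: h_def spread_def)
    show ?thesis
    proof (cases "e' = e")
      case True
      have "depth e (r x i) < ?\<rho>" "depth e (r x j) < ?\<rho>"
        using m' True push_mem_same_edge_iff[OF e second_depth_pos[OF e r_sink_configs[OF x]] second_depth_le_1]
        by auto
      then show ?thesis using second_depth_le[OF i j, of e "r x"] by fastforce
    next
      case False
      then have "e' \<in> A" "e' \<in> E" using e' insert.prems by auto
      then show ?thesis
        using r(3) x i j push_mem_edge[OF e, of e'] m' by blast
    qed
  qed
  show ?case using 1 2 3 by blast
qed

lemma homotopy_equivalent_uncrowded:
  "sink_conf n G V homotopy_equivalent_space subtopology (product_topology (\<lambda>_. G) {..<n}) (uncrowded n)"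
    (is "?C homotopy_equivalent_space ?X")
proof -
  obtain r where r: "homotopic_with (\<lambda>x. True) ?C ?C id r" "\<forall>x\<in>uncrowded n. r x = x"
    "\<forall>x\<in>sink_configs n. \<forall>e\<in>E. \<forall>i<n. \<forall>j<n. r x i \<in> e \<longrightarrow> r x j \<in> e \<longrightarrow> i = j"
    using retraction_over_edges[OF order_refl, of n] by (elim exE conjE) (rule that)
  have X: "?X = subtopology ?C (uncrowded n)"
  proof -
    have "sink_configs n \<inter> uncrowded n = uncrowded n"
      using uncrowded_subset_sink_configs[of n] by blast
    then show ?thesis by (simp add: sink_conf_eq subtopology_subtopology)
  qed
  have rc: "continuous_map ?C ?C r"
    using homotopic_with_imp_continuous_maps[OF r(1)] by blast
  have rs: "r x \<in> uncrowded n" if x: "x \<in> sink_configs n" for x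
  proof -
    have "r x \<in> sink_configs n" using rc x by (auto simp: continuous_map_def topspace_sink_conf)
    then show ?thesis using r(3) x by (auto simp: uncrowded_def sink_configs_def)
  qed
  have "retraction_maps ?C ?X r id"
    unfolding retraction_maps_def X
  proof (intro conjI ballI)
    show "continuous_map ?C (subtopology ?C (uncrowded n)) r"
      using rc rs by (auto simp: continuous_map_in_subtopology topspace_sink_conf)
    show "continuous_map (subtopology ?C (uncrowded n)) ?C id"
      by (rule continuous_map_from_subtopology) simp
    show "r (id x) = x" if "x \<in> topspace (subtopology ?C (uncrowded n))" for x
      using that r(2) by (simp add: topspace_subtopology)
  qed
  then show ?thesis
    using deformation_retract_imp_homotopy_equivalent_space[of ?C r ?X] r(1)
    by (simp add: homotopic_with_sym)
qed

end

section \<open>The cell structure\<close>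

text \<open>
  A continuous map from a compact to a Hausdorff space is closed, and closedness passes to the restriction
  to a full preimage. This is how an open cell inherits its chart from the closed disc.
\<close>

lemma homeomorphic_map_on_saturated:
  assumes f: "continuous_map X Y f" and X: "compact_space X" and Y: "Hausdorff_space Y"
    and U: "{x \<in> topspace X. f x \<in> c} = U" and inj: "inj_on f U"
    and c: "c \<subseteq> f ` topspace X"
  shows "homeomorphic_map (subtopology X U) (subtopology Y c) f"
proof (rule bijective_closed_imp_homeomorphic_map)
  have cY: "c \<subseteq> topspace Y"
    using c continuous_map_image_subset_topspace[OF f] by blast
  have U': "topspace (subtopology X U) = U" and c': "topspace (subtopology Y c) = c"
    using U cY by auto
  show "continuous_map (subtopology X U) (subtopology Y c) f"
    using f U by (auto simp: continuous_map_in_subtopology continuous_map_from_subtopology)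
  show "closed_map (subtopology X U) (subtopology Y c) f"
    using continuous_imp_closed_map[OF f X Y] U by (rule closed_map_restriction)
  show "f ` topspace (subtopology X U) = topspace (subtopology Y c)"
    unfolding U' c' using U c by blast
  show "inj_on f (topspace (subtopology X U))"
    unfolding U' by (rule inj)
qed

lemma mem_open_face_empty:
  "x \<in> open_face k {} {} \<longleftrightarrow> x \<in> topspace (unit_cube k) \<and> (\<forall>i<k. 0 < x i \<and> x i < 1)"
  by (auto simp: open_face_def closed_face_def)

context param_graph
begin

definition cells :: "'a set set" where
  "cells = (\<lambda>v. {v}) ` V \<union> E"

lemma cells_cases:
  assumes "c \<in> cells"
  obtains v where "v \<in> V" "c = {v}" "c \<notin> E" | "c \<in> E"
  using assms vertex_notin_edge by (auto simp: cells_def)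

lemma cell_unique: "c \<in> cells \<Longrightarrow> c' \<in> cells \<Longrightarrow> p \<in> c \<Longrightarrow> p \<in> c' \<Longrightarrow> c = c'"
  unfolding cells_def by (elim UnE imageE) (use vertex_notin_edge edges_disjoint in blast)+

lemma ex_cell: "p \<in> topspace G \<Longrightarrow> \<exists>c\<in>cells. p \<in> c"
  by (erule edge_cases) (auto simp: cells_def)

lemma cell_subset_topspace: "c \<in> cells \<Longrightarrow> c \<subseteq> topspace G"
  by (auto simp: cells_def topspace_graph)

lemma mem_cell_vertex_iff: "c \<in> cells \<Longrightarrow> p \<in> c \<Longrightarrow> p \<in> V \<longleftrightarrow> c \<notin> E"
  by (erule cells_cases) (auto simp: vertex_notin_edge)

lemma finite_cells: "finite cells"
  by (simp add: cells_def finite_vertices finite_edges)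

definition cell_param :: "'a set \<Rightarrow> real \<Rightarrow> 'a" where
  "cell_param c t = (if c \<in> E then \<gamma> c t else the_elem c)"

lemma continuous_cell_param:
  assumes "c \<in> cells"
  shows "continuous_map (top_of_set {0..1}) G (cell_param c)"
  using assms
proof (cases rule: cells_cases)
  case (1 v)
  then show ?thesis
    by (simp add: cell_param_def[abs_def] topspace_graph)
next
  case 2
  then show ?thesis
    by (simp add: cell_param_def[abs_def] continuous_edge)
qed

lemma mem_vertex_cell_iff: "c \<in> cells \<Longrightarrow> c \<notin> E \<Longrightarrow> p \<in> c \<longleftrightarrow> p = cell_param c t"
  by (erule cells_cases) (auto simp: cell_param_def)

lemma cell_param_mem_iff:
  assumes "c \<in> cells" "0 \<le> t" "t \<le> 1"
  shows "cell_param c t \<in> c \<longleftrightarrow> (c \<in> E \<longrightarrow> 0 < t \<and> t < 1)"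
  using assms(1)
  by (cases rule: cells_cases) (auto simp: cell_param_def edge_mem_iff assms)

lemma cell_param_vertex_iff:
  assumes "c \<in> cells" "0 \<le> t" "t \<le> 1"
  shows "cell_param c t \<in> V \<longleftrightarrow> (c \<in> E \<longrightarrow> t = 0 \<or> t = 1)"
  using assms(1)
proof (cases rule: cells_cases)
  case 2
  show ?thesis
  proof (cases "t = 0 \<or> t = 1")
    case True
    then show ?thesis using 2 edge_ends by (auto simp: cell_param_def)
  next
    case False
    then have "\<gamma> c t \<in> c" using 2 assms edge_mem_iff[of c t] by auto
    then show ?thesis using 2 False vertex_notin_edge by (auto simp: cell_param_def)
  qed
qed (auto simp: cell_param_def)

lemma cell_param_mem_other_edge:
  assumes "c \<in> cells" "0 \<le> t" "t \<le> 1" "e \<in> E" "cell_param c t \<in> e"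
  shows "c = e"
proof -
  have "cell_param c t \<notin> V" using assms(4,5) vertex_notin_edge by blast
  then have "cell_param c t \<in> c"
    using assms cell_param_vertex_iff[OF assms(1-3)] cell_param_mem_iff[OF assms(1-3)] by auto
  then show ?thesis using assms cell_unique[of c e] by (auto simp: cells_def)
qed

text \<open>
  The cells of \<open>G\<^sup>n\<close> are the products \<open>\<sigma> 0 \<times> \<dots> \<times> \<sigma> (n - 1)\<close> of cells of \<open>G\<close>. The labels are those \<open>\<sigma>\<close> that use no
  edge twice.
\<close>

definition labels :: "nat \<Rightarrow> (nat \<Rightarrow> 'a set) set" where
  "labels n = {\<sigma> \<in> PiE {..<n} (\<lambda>_. cells). \<forall>i<n. \<forall>j<n. \<sigma> i \<in> E \<longrightarrow> \<sigma> i = \<sigma> j \<longrightarrow> i = j}"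

definition edge_positions :: "nat \<Rightarrow> (nat \<Rightarrow> 'a set) \<Rightarrow> nat set" where
  "edge_positions n \<sigma> = {i. i < n \<and> \<sigma> i \<in> E}"

definition label_dim :: "nat \<Rightarrow> (nat \<Rightarrow> 'a set) \<Rightarrow> nat" where
  "label_dim n \<sigma> = card (edge_positions n \<sigma>)"

definition product_cells :: "nat \<Rightarrow> nat \<Rightarrow> (nat \<Rightarrow> 'a) set set" where
  "product_cells n k = {PiE {..<n} \<sigma> | \<sigma>. \<sigma> \<in> labels n \<and> label_dim n \<sigma> = k}"

lemma finite_edge_positions: "finite (edge_positions n \<sigma>)"
  by (simp add: edge_positions_def)

lemma label_cell: "\<sigma> \<in> labels n \<Longrightarrow> i < n \<Longrightarrow> \<sigma> i \<in> cells"
  by (auto simp: labels_def PiE_iff)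

lemma label_inj: "\<sigma> \<in> labels n \<Longrightarrow> i < n \<Longrightarrow> j < n \<Longrightarrow> \<sigma> i \<in> E \<Longrightarrow> \<sigma> i = \<sigma> j \<Longrightarrow> i = j"
  unfolding labels_def by blast

text \<open>
  Edge factors at different positions are different edges; this is where the dimension bound \<open>|E|\<close> comes from.
\<close>

lemma label_dim_le:
  assumes "\<sigma> \<in> labels n"
  shows "label_dim n \<sigma> \<le> card E"
  unfolding label_dim_def
proof (rule card_inj_on_le[OF _ _ finite_edges])
  show "inj_on \<sigma> (edge_positions n \<sigma>)"
    using label_inj[OF assms] by (auto simp: inj_on_def edge_positions_def)
qed (auto simp: edge_positions_def)

lemma finite_labels: "finite (labels n)"
  by (rule finite_subset[of _ "PiE {..<n} (\<lambda>_. cells)"])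
    (auto simp: labels_def finite_cells intro: finite_PiE)

lemma label_unique:
  assumes "\<sigma> \<in> labels n" "\<tau> \<in> labels n" "x \<in> PiE {..<n} \<sigma>" "x \<in> PiE {..<n} \<tau>"
  shows "\<sigma> = \<tau>"
proof (rule PiE_ext)
  show "\<sigma> \<in> PiE {..<n} (\<lambda>_. cells)" "\<tau> \<in> PiE {..<n} (\<lambda>_. cells)"
    using assms by (auto simp: labels_def)
  fix i assume "i \<in> {..<n}"
  then show "\<sigma> i = \<tau> i"
    using assms label_cell cell_unique[of "\<sigma> i" "\<tau> i" "x i"] by (auto simp: PiE_iff)
qed

lemma product_cell_subset_uncrowded:
  assumes "\<sigma> \<in> labels n"
  shows "PiE {..<n} \<sigma> \<subseteq> uncrowded n"
proof
  fix x assume x: "x \<in> PiE {..<n} \<sigma>"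
  have xi: "x i \<in> \<sigma> i" "\<sigma> i \<in> cells" if "i < n" for i
    using x label_cell[OF assms] that by auto
  have "x \<in> PiE {..<n} (\<lambda>_. topspace G)"
    using x xi cell_subset_topspace by (auto simp: PiE_iff)
  moreover have "i = j" if "e \<in> E" "i < n" "j < n" "x i \<in> e" "x j \<in> e" for e i j
  proof -
    have "e \<in> cells" using that by (simp add: cells_def)
    then have "\<sigma> i = e" "\<sigma> j = e" using that xi cell_unique by metis+
    then show ?thesis using label_inj[OF assms, of i j] that by simp
  qed
  ultimately show "x \<in> uncrowded n" unfolding uncrowded_def by blast
qed

lemma uncrowded_mem_product_cell:
  assumes x: "x \<in> uncrowded n"
  obtains \<sigma> where "\<sigma> \<in> labels n" "x \<in> PiE {..<n} \<sigma>"
proof -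
  have x': "x \<in> PiE {..<n} (\<lambda>_. topspace G)" using x by (simp add: uncrowded_def)
  then have "\<forall>i\<in>{..<n}. \<exists>c\<in>cells. x i \<in> c" using ex_cell by (auto simp: PiE_iff)
  then obtain f where f: "\<And>i. i < n \<Longrightarrow> f i \<in> cells \<and> x i \<in> f i" by (metis lessThan_iff)
  let ?\<sigma> = "restrict f {..<n}"
  have "i = j" if "i < n" "j < n" "f i \<in> E" "f i = f j" for i j
    using uncrowdedD[OF x that(3,1,2)] f[of i] f[of j] that by simp
  then have "?\<sigma> \<in> labels n" using f by (auto simp: labels_def)
  moreover have "x \<in> PiE {..<n} ?\<sigma>" using f x' by (auto simp: PiE_iff)
  ultimately show ?thesis by (rule that)
qed

lemma edge_positions_eq:
  assumes "\<sigma> \<in> labels n" "x \<in> PiE {..<n} \<sigma>"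
  shows "edge_positions n \<sigma> = {i. i < n \<and> x i \<notin> V}"
proof -
  have "\<sigma> i \<in> E \<longleftrightarrow> x i \<notin> V" if "i < n" for i
    using mem_cell_vertex_iff[OF label_cell[OF assms(1) that], of "x i"] assms(2) that by auto
  then show ?thesis by (auto simp: edge_positions_def)
qed

text \<open>
  The dimension of the cell that contains \<open>x\<close> can be read off from \<open>x\<close>, which gives the union of all cells
  of a fixed dimension without reference to labels.
\<close>

lemma Union_product_cells:
  "\<Union>(product_cells n k) = {x \<in> uncrowded n. card {i. i < n \<and> x i \<notin> V} = k}"
proof (intro equalityI subsetI)
  fix x assume "x \<in> \<Union>(product_cells n k)"
  then obtain \<sigma> where "\<sigma> \<in> labels n" "label_dim n \<sigma> = k" "x \<in> PiE {..<n} \<sigma>"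
    by (auto simp: product_cells_def)
  then show "x \<in> {x \<in> uncrowded n. card {i. i < n \<and> x i \<notin> V} = k}"
    using product_cell_subset_uncrowded edge_positions_eq by (auto simp: label_dim_def)
next
  fix x assume x: "x \<in> {x \<in> uncrowded n. card {i. i < n \<and> x i \<notin> V} = k}"
  then obtain \<sigma> where \<sigma>: "\<sigma> \<in> labels n" "x \<in> PiE {..<n} \<sigma>"
    using uncrowded_mem_product_cell by blast
  then have "label_dim n \<sigma> = k" using x edge_positions_eq by (auto simp: label_dim_def)
  then show "x \<in> \<Union>(product_cells n k)" using \<sigma> by (auto simp: product_cells_def)
qed

definition uncrowded_conf :: "nat \<Rightarrow> (nat \<Rightarrow> 'a) topology" where
  "uncrowded_conf n = subtopology (product_topology (\<lambda>_. G) {..<n}) (uncrowded n)"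

lemma topspace_uncrowded_conf: "topspace (uncrowded_conf n) = uncrowded n"
  by (auto simp: uncrowded_conf_def uncrowded_def)

lemma Hausdorff_uncrowded_conf: "Hausdorff_space (uncrowded_conf n)"
  unfolding uncrowded_conf_def
  by (intro Hausdorff_space_subtopology) (simp add: Hausdorff_space_product_topology Hausdorff)

text \<open>
  A cube must have consecutive coordinates, whereas the edge factors of a cell sit at arbitrary positions.
  An enumeration of these positions is fixed for each label.
\<close>

definition slot :: "nat \<Rightarrow> (nat \<Rightarrow> 'a set) \<Rightarrow> nat \<Rightarrow> nat" where
  "slot n \<sigma> = (SOME f. bij_betw f (edge_positions n \<sigma>) {..<label_dim n \<sigma>})"

lemma bij_slot: "bij_betw (slot n \<sigma>) (edge_positions n \<sigma>) {..<label_dim n \<sigma>}"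
proof -
  have "\<exists>f. bij_betw f (edge_positions n \<sigma>) {..<label_dim n \<sigma>}"
    using ex_bij_betw_finite_nat[OF finite_edge_positions[of n \<sigma>]]
    by (simp add: label_dim_def atLeast0LessThan)
  then show ?thesis unfolding slot_def by (rule someI_ex)
qed

definition slot_position :: "nat \<Rightarrow> (nat \<Rightarrow> 'a set) \<Rightarrow> nat \<Rightarrow> nat" where
  "slot_position n \<sigma> = the_inv_into (edge_positions n \<sigma>) (slot n \<sigma>)"

lemma slot_less: "i \<in> edge_positions n \<sigma> \<Longrightarrow> slot n \<sigma> i < label_dim n \<sigma>"
  using bij_slot[of n \<sigma>] by (auto simp: bij_betw_def)

lemma slot_position_slot: "i \<in> edge_positions n \<sigma> \<Longrightarrow> slot_position n \<sigma> (slot n \<sigma> i) = i"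
  unfolding slot_position_def using bij_slot[of n \<sigma>] by (simp add: bij_betw_def the_inv_into_f_f)

lemma slot_position:
  assumes "m < label_dim n \<sigma>"
  shows "slot_position n \<sigma> m \<in> edge_positions n \<sigma>" "slot n \<sigma> (slot_position n \<sigma> m) = m"
proof -
  obtain i where "i \<in> edge_positions n \<sigma>" "m = slot n \<sigma> i"
    using bij_slot[of n \<sigma>] assms by (auto simp: bij_betw_def)
  then show "slot_position n \<sigma> m \<in> edge_positions n \<sigma>" "slot n \<sigma> (slot_position n \<sigma> m) = m"
    by (auto simp: slot_position_slot)
qed

text \<open>
  As \<open>cell_param\<close> is constant on a vertex, \<open>slot\<close> may be evaluated at every position, whatever its value
  at the positions of the vertex factors.
\<close>

definition cube_map :: "nat \<Rightarrow> (nat \<Rightarrow> 'a set) \<Rightarrow> (nat \<Rightarrow> real) \<Rightarrow> nat \<Rightarrow> 'a" where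
  "cube_map n \<sigma> x = (\<lambda>i\<in>{..<n}. cell_param (\<sigma> i) (x (slot n \<sigma> i)))"

abbreviation cube_of :: "nat \<Rightarrow> (nat \<Rightarrow> 'a set) \<Rightarrow> (nat \<Rightarrow> real) topology" where
  "cube_of n \<sigma> \<equiv> unit_cube (label_dim n \<sigma>)"

lemma continuous_cube_map:
  assumes \<sigma>: "\<sigma> \<in> labels n"
  shows "continuous_map (cube_of n \<sigma>) (uncrowded_conf n) (cube_map n \<sigma>)"
proof -
  have c: "continuous_map (cube_of n \<sigma>) (product_topology (\<lambda>_. G) {..<n}) (cube_map n \<sigma>)"
    unfolding continuous_map_componentwise
  proof (intro conjI ballI)
    fix i assume "i \<in> {..<n}"
    then have i: "i < n" by simp
    have "continuous_map (cube_of n \<sigma>) euclideanreal (\<lambda>x. x (slot n \<sigma> i))"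
      unfolding unit_cube_def by (rule continuous_map_coordinate_subtopology)
    then have "continuous_map (cube_of n \<sigma>) (top_of_set {0..1}) (\<lambda>x. x (slot n \<sigma> i))"
      using unit_cube_nonneg_le_1 by (auto simp: continuous_map_in_subtopology)
    from continuous_map_compose[OF this continuous_cell_param[OF label_cell[OF \<sigma> i]]]
    show "continuous_map (cube_of n \<sigma>) G (\<lambda>x. cube_map n \<sigma> x i)"
      using i by (simp add: cube_map_def o_def)
  qed (auto simp: cube_map_def)
  have "cube_map n \<sigma> x \<in> uncrowded n" if x: "x \<in> topspace (cube_of n \<sigma>)" for x
  proof -
    have "cube_map n \<sigma> x \<in> PiE {..<n} (\<lambda>_. topspace G)"
      using continuous_map_image_subset_topspace[OF c] x by auto
    moreover have "i = j" if "e \<in> E" "i < n" "j < n" "cube_map n \<sigma> x i \<in> e" "cube_map n \<sigma> x j \<in> e" for e i j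
    proof -
      have "\<sigma> k = e" if "k < n" "cube_map n \<sigma> x k \<in> e" for k
        using cell_param_mem_other_edge[OF label_cell[OF \<sigma> that(1)], of "x (slot n \<sigma> k)" e]
          unit_cube_nonneg_le_1[OF x, of "slot n \<sigma> k"] that \<open>e \<in> E\<close> by (simp add: cube_map_def)
      then show ?thesis using that label_inj[OF \<sigma>, of i j] by simp
    qed
    ultimately show ?thesis unfolding uncrowded_def by blast
  qed
  then show ?thesis
    using c by (auto simp: uncrowded_conf_def continuous_map_in_subtopology)
qed

lemma cube_map_mem_product_cell_iff:
  assumes \<sigma>: "\<sigma> \<in> labels n" and x: "x \<in> topspace (cube_of n \<sigma>)"
  shows "cube_map n \<sigma> x \<in> PiE {..<n} \<sigma> \<longleftrightarrow> x \<in> open_face (label_dim n \<sigma>) {} {}"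
proof -
  have "cube_map n \<sigma> x i \<in> \<sigma> i \<longleftrightarrow> (\<sigma> i \<in> E \<longrightarrow> 0 < x (slot n \<sigma> i) \<and> x (slot n \<sigma> i) < 1)" if "i < n" for i
    using cell_param_mem_iff[OF label_cell[OF \<sigma> that]] unit_cube_nonneg_le_1[OF x] that
    by (simp add: cube_map_def)
  then have "cube_map n \<sigma> x \<in> PiE {..<n} \<sigma> \<longleftrightarrow>
      (\<forall>i\<in>edge_positions n \<sigma>. 0 < x (slot n \<sigma> i) \<and> x (slot n \<sigma> i) < 1)"
    by (auto simp: PiE_iff edge_positions_def cube_map_def)
  also have "\<dots> \<longleftrightarrow> (\<forall>m<label_dim n \<sigma>. 0 < x m \<and> x m < 1)"
    using slot_less slot_position by metis
  finally show ?thesis using x by (simp add: mem_open_face_empty)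
qed

lemma cube_map_coord:
  assumes \<sigma>: "\<sigma> \<in> labels n" and x: "x \<in> topspace (cube_of n \<sigma>)"
    and m: "m < label_dim n \<sigma>" "0 < x m" "x m < 1"
  shows "x m = coord (\<sigma> (slot_position n \<sigma> m)) (cube_map n \<sigma> x (slot_position n \<sigma> m))"
  using slot_position[OF m(1)] m coord_edge
  by (simp add: cube_map_def edge_positions_def cell_param_def)

lemma inj_on_cube_map_open_cube:
  assumes \<sigma>: "\<sigma> \<in> labels n"
  shows "inj_on (cube_map n \<sigma>) (open_face (label_dim n \<sigma>) {} {})"
proof (rule inj_onI)
  fix x y assume xy: "x \<in> open_face (label_dim n \<sigma>) {} {}" "y \<in> open_face (label_dim n \<sigma>) {} {}"
    and eq: "cube_map n \<sigma> x = cube_map n \<sigma> y"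
  show "x = y"
  proof
    fix m
    show "x m = y m"
    proof (cases "m < label_dim n \<sigma>")
      case True
      then show ?thesis
        using xy eq cube_map_coord[OF \<sigma> _ True, of x] cube_map_coord[OF \<sigma> _ True, of y]
        by (simp add: mem_open_face_empty)
    next
      case False
      then show ?thesis using xy by (simp add: mem_open_face_empty topspace_unit_cube)
    qed
  qed
qed

text \<open>
  The cell of \<open>G\<^sup>n\<close> onto which the open face given by \<open>A\<close> and \<open>B\<close> is mapped: an edge factor whose coordinate is fixed
  becomes the corresponding end.
\<close>

definition face_label :: "nat \<Rightarrow> (nat \<Rightarrow> 'a set) \<Rightarrow> nat set \<Rightarrow> nat set \<Rightarrow> nat \<Rightarrow> 'a set" where
  "face_label n \<sigma> A B = (\<lambda>i\<in>{..<n}.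
     if \<sigma> i \<in> E \<and> slot n \<sigma> i \<in> A then {\<gamma> (\<sigma> i) 0}
     else if \<sigma> i \<in> E \<and> slot n \<sigma> i \<in> B then {\<gamma> (\<sigma> i) 1}
     else \<sigma> i)"

lemma face_label_edge_iff:
  assumes "\<sigma> \<in> labels n" "i < n"
  shows "face_label n \<sigma> A B i \<in> E \<longleftrightarrow> \<sigma> i \<in> E \<and> slot n \<sigma> i \<notin> A \<union> B"
proof -
  have "{v} \<notin> E" if "v \<in> V" for v using vertex_notin_edge[OF that, of "{v}"] by blast
  then show ?thesis using assms edge_ends[of "\<sigma> i"] by (auto simp: face_label_def)
qed

lemma face_label_mem:
  assumes \<sigma>: "\<sigma> \<in> labels n"
  shows "face_label n \<sigma> A B \<in> labels n"
proof -
  have "face_label n \<sigma> A B i \<in> cells" if "i < n" for i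
    using that label_cell[OF \<sigma> that] edge_ends[of "\<sigma> i"] by (auto simp: face_label_def cells_def)
  then have "face_label n \<sigma> A B \<in> PiE {..<n} (\<lambda>_. cells)"
    by (auto simp: face_label_def)
  moreover have "i = j" if "i < n" "j < n" "face_label n \<sigma> A B i \<in> E"
      "face_label n \<sigma> A B i = face_label n \<sigma> A B j" for i j
  proof -
    have "face_label n \<sigma> A B i = \<sigma> i \<and> \<sigma> i \<in> E" if "i < n" "face_label n \<sigma> A B i \<in> E" for i
      using that face_label_edge_iff[OF \<sigma> that(1), of A B] by (auto simp: face_label_def)
    then show ?thesis using label_inj[OF \<sigma>, of i j] that by metis
  qed
  ultimately show ?thesis unfolding labels_def by blast
qed

lemma label_dim_face_label:
  assumes \<sigma>: "\<sigma> \<in> labels n" and "face_index (label_dim n \<sigma>) A B"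
  shows "label_dim n \<sigma> = label_dim n (face_label n \<sigma> A B) + card (A \<union> B)"
proof -
  let ?P = "edge_positions n \<sigma>" and ?Q = "edge_positions n (face_label n \<sigma> A B)"
  have AB: "A \<union> B \<subseteq> {..<label_dim n \<sigma>}" using assms(2) by (auto simp: face_index_def)
  have Q: "?Q = {i \<in> ?P. slot n \<sigma> i \<notin> A \<union> B}"
    using face_label_edge_iff[OF \<sigma>, of _ A B] by (auto simp: edge_positions_def)
  have "bij_betw (slot n \<sigma>) (?P - ?Q) (A \<union> B)"
    unfolding bij_betw_def
  proof
    show "inj_on (slot n \<sigma>) (?P - ?Q)"
      using bij_slot[of n \<sigma>] by (auto simp: bij_betw_def intro: inj_on_subset)
    show "slot n \<sigma> ` (?P - ?Q) = A \<union> B"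
    proof (intro equalityI subsetI)
      fix m assume m: "m \<in> A \<union> B"
      then have "m < label_dim n \<sigma>" using AB by blast
      then show "m \<in> slot n \<sigma> ` (?P - ?Q)"
        using slot_position[of m n \<sigma>] m unfolding Q
        by (intro image_eqI[of _ _ "slot_position n \<sigma> m"]) auto
    qed (auto simp: Q)
  qed
  then have "card (?P - ?Q) = card (A \<union> B)" by (rule bij_betw_same_card)
  moreover have "card ?P = card ?Q + card (?P - ?Q)"
    by (subst card_Un_disjoint[symmetric]) (auto simp: finite_edge_positions Q intro!: arg_cong[where f = card])
  ultimately show ?thesis by (simp add: label_dim_def)
qed

lemma mem_open_face:
  "x \<in> open_face k A B \<longleftrightarrow> x \<in> topspace (unit_cube k) \<and> (\<forall>i\<in>A. x i = 0) \<and> (\<forall>i\<in>B. x i = 1) \<and>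
     (\<forall>i<k. i \<notin> A \<union> B \<longrightarrow> 0 < x i \<and> x i < 1)"
  by (auto simp: open_face_def closed_face_def)

lemma cube_map_open_face:
  assumes \<sigma>: "\<sigma> \<in> labels n" and AB: "face_index (label_dim n \<sigma>) A B"
  shows "cube_map n \<sigma> ` open_face (label_dim n \<sigma>) A B = PiE {..<n} (face_label n \<sigma> A B)"
proof (intro equalityI subsetI)
  fix y assume "y \<in> cube_map n \<sigma> ` open_face (label_dim n \<sigma>) A B"
  then obtain x where x: "x \<in> open_face (label_dim n \<sigma>) A B" "y = cube_map n \<sigma> x" by blast
  have "y i \<in> face_label n \<sigma> A B i" if i: "i < n" for i
  proof (cases "\<sigma> i \<in> E")
    case True
    then have "slot n \<sigma> i < label_dim n \<sigma>" using i by (intro slot_less) (simp add: edge_positions_def)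
    then show ?thesis
      using x i True edge_mem_iff[OF True, of "x (slot n \<sigma> i)"]
      by (auto simp: mem_open_face cube_map_def face_label_def cell_param_def)
  next
    case False
    then show ?thesis
      using x i mem_vertex_cell_iff[OF label_cell[OF \<sigma> i] False, of "y i" "x (slot n \<sigma> i)"]
      by (simp add: cube_map_def face_label_def)
  qed
  then show "y \<in> PiE {..<n} (face_label n \<sigma> A B)"
    using x by (auto simp: PiE_iff cube_map_def)
next
  fix y assume y: "y \<in> PiE {..<n} (face_label n \<sigma> A B)"
  define x where "x = (\<lambda>m. if m < label_dim n \<sigma> then
      (if m \<in> A then 0 else if m \<in> B then 1
       else coord (\<sigma> (slot_position n \<sigma> m)) (y (slot_position n \<sigma> m))) else 0)"
  have AB': "A \<subseteq> {..<label_dim n \<sigma>}" "B \<subseteq> {..<label_dim n \<sigma>}" "A \<inter> B = {}"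
    using AB by (auto simp: face_index_def)
  have free: "0 < x m" "x m < 1" "\<gamma> (\<sigma> (slot_position n \<sigma> m)) (x m) = y (slot_position n \<sigma> m)"
    if m: "m < label_dim n \<sigma>" "m \<notin> A \<union> B" for m
  proof -
    let ?i = "slot_position n \<sigma> m"
    have i: "?i < n" "\<sigma> ?i \<in> E" "slot n \<sigma> ?i = m"
      using slot_position[OF m(1)] by (auto simp: edge_positions_def)
    have "y ?i \<in> face_label n \<sigma> A B ?i" using y i by auto
    then have "y ?i \<in> \<sigma> ?i" using i m by (simp add: face_label_def)
    then show "0 < x m" "x m < 1" "\<gamma> (\<sigma> ?i) (x m) = y ?i"
      using edge_coord[OF i(2)] m by (auto simp: x_def)
  qed
  have "x \<in> open_face (label_dim n \<sigma>) A B"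
    unfolding mem_open_face topspace_unit_cube
  proof (intro conjI)
    show "x \<in> {x. (\<forall>i\<ge>label_dim n \<sigma>. x i = 0) \<and> (\<forall>i<label_dim n \<sigma>. 0 \<le> x i \<and> x i \<le> 1)}"
    proof -
      have "0 \<le> x i \<and> x i \<le> 1" if "i < label_dim n \<sigma>" for i
        using free(1,2)[of i] that by (cases "i \<in> A \<union> B") (auto simp: x_def)
      then show ?thesis by (simp add: x_def)
    qed
    show "\<forall>i\<in>A. x i = 0" "\<forall>i\<in>B. x i = 1"
      using AB' by (auto simp: x_def)
    show "\<forall>i<label_dim n \<sigma>. i \<notin> A \<union> B \<longrightarrow> 0 < x i \<and> x i < 1"
      using free(1,2) by blast
  qed
  moreover have "y = cube_map n \<sigma> x"
  proof (rule extensionalityI)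
    show "y \<in> extensional {..<n}" using y by (auto simp: PiE_iff)
    show "cube_map n \<sigma> x \<in> extensional {..<n}" by (simp add: cube_map_def)
    fix i assume "i \<in> {..<n}"
    then have i: "i < n" by simp
    have yi: "y i \<in> face_label n \<sigma> A B i" using y i by auto
    show "y i = cube_map n \<sigma> x i"
    proof (cases "\<sigma> i \<in> E")
      case True
      then have ip: "i \<in> edge_positions n \<sigma>" using i by (simp add: edge_positions_def)
      then have s: "slot n \<sigma> i < label_dim n \<sigma>" "slot_position n \<sigma> (slot n \<sigma> i) = i"
        by (auto simp: slot_less slot_position_slot)
      show ?thesis
        using yi i True s free(3)[OF s(1)] AB'
        by (cases "slot n \<sigma> i \<in> A \<union> B") (auto simp: cube_map_def face_label_def cell_param_def x_def)
    next
      case False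
      then show ?thesis
        using yi i mem_vertex_cell_iff[OF label_cell[OF \<sigma> i] False, of "y i" "x (slot n \<sigma> i)"]
        by (simp add: cube_map_def face_label_def)
    qed
  qed
  ultimately show "y \<in> cube_map n \<sigma> ` open_face (label_dim n \<sigma>) A B" by blast
qed

lemma face_label_empty: "\<sigma> \<in> labels n \<Longrightarrow> face_label n \<sigma> {} {} = \<sigma>"
  by (rule extensionalityI[of _ "{..<n}"]) (auto simp: face_label_def labels_def PiE_iff)

lemma cube_map_open_cube:
  "\<sigma> \<in> labels n \<Longrightarrow> cube_map n \<sigma> ` open_face (label_dim n \<sigma>) {} {} = PiE {..<n} \<sigma>"
  using cube_map_open_face[of \<sigma> n "{}" "{}"] by (simp add: face_label_empty face_index_def)

text \<open>
  At a boundary point some coordinate is 0 or 1, so one of the edge factors has degenerated to a vertex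
  and fewer points than before lie in open edges.
\<close>

lemma cube_map_boundary:
  assumes \<sigma>: "\<sigma> \<in> labels n" and x: "x \<in> topspace (cube_of n \<sigma>)" "x \<notin> open_face (label_dim n \<sigma>) {} {}"
  shows "cube_map n \<sigma> x \<in> (\<Union>j<label_dim n \<sigma>. \<Union>(product_cells n j))"
proof -
  let ?y = "cube_map n \<sigma> x"
  let ?Q = "{i. i < n \<and> ?y i \<notin> V}"
  have y: "?y \<in> uncrowded n"
    using continuous_map_image_subset_topspace[OF continuous_cube_map[OF \<sigma>]] x(1)
    by (auto simp: topspace_uncrowded_conf)
  have v: "?y i \<in> V \<longleftrightarrow> (\<sigma> i \<in> E \<longrightarrow> x (slot n \<sigma> i) = 0 \<or> x (slot n \<sigma> i) = 1)" if "i < n" for i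
    using cell_param_vertex_iff[OF label_cell[OF \<sigma> that]] unit_cube_nonneg_le_1[OF x(1)] that
    by (simp add: cube_map_def)
  have "?Q \<subseteq> edge_positions n \<sigma>" using v by (auto simp: edge_positions_def)
  moreover obtain m where m: "m < label_dim n \<sigma>" "\<not> (0 < x m \<and> x m < 1)"
    using x by (auto simp: mem_open_face_empty)
  then have "x m = 0 \<or> x m = 1"
    using unit_cube_nonneg_le_1[OF x(1), of m] by auto
  then have "slot_position n \<sigma> m \<in> edge_positions n \<sigma> - ?Q"
    using slot_position[OF m(1)] v by (auto simp: edge_positions_def)
  ultimately have "?Q \<subset> edge_positions n \<sigma>" by blast
  then have "card ?Q < label_dim n \<sigma>"
    unfolding label_dim_def using finite_edge_positions by (rule psubset_card_mono[rotated])
  moreover have "?y \<in> \<Union>(product_cells n (card ?Q))"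
    unfolding Union_product_cells using y by simp
  ultimately show ?thesis by blast
qed

lemma characteristic_map_cube_map:
  assumes \<sigma>: "\<sigma> \<in> labels n"
  shows "characteristic_map (uncrowded_conf n) (product_cells n) (label_dim n \<sigma>) (PiE {..<n} \<sigma>)
    (cube_map n \<sigma> \<circ> disc_to_cube (label_dim n \<sigma>))" (is "characteristic_map ?X ?K ?k ?c ?\<phi>")
  unfolding characteristic_map_def
proof (intro conjI)
  have "homeomorphic_map (disc ?k) (cube_of n \<sigma>) (disc_to_cube ?k)"
    using homeomorphic_maps_disc_cube homeomorphic_map_maps by blast
  then have cd: "continuous_map (disc ?k) (cube_of n \<sigma>) (disc_to_cube ?k)"
    and sd: "disc_to_cube ?k ` topspace (disc ?k) = topspace (cube_of n \<sigma>)"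
    and id: "inj_on (disc_to_cube ?k) (topspace (disc ?k))"
    by (auto dest: homeomorphic_imp_continuous_map homeomorphic_imp_surjective_map homeomorphic_imp_injective_map)
  show c: "continuous_map (disc ?k) ?X ?\<phi>"
    using cd continuous_cube_map[OF \<sigma>] by (rule continuous_map_compose)
  have U: "{x \<in> topspace (disc ?k). ?\<phi> x \<in> ?c} = disc_interior ?k"
  proof -
    have "?\<phi> x \<in> ?c \<longleftrightarrow> x \<in> disc_interior ?k" if "x \<in> topspace (disc ?k)" for x
      unfolding o_def cube_map_mem_product_cell_iff[OF \<sigma> disc_to_cube_mem(1)[OF that]]
      by (rule disc_to_cube_mem(2)[OF that])
    moreover have "disc_interior ?k \<subseteq> topspace (disc ?k)" by (auto simp: disc_interior_def)
    ultimately show ?thesis by blast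
  qed
  show "homeomorphic_map (subtopology (disc ?k) (disc_interior ?k)) (subtopology ?X ?c) ?\<phi>"
  proof (rule homeomorphic_map_on_saturated[OF c compact_space_disc Hausdorff_uncrowded_conf U])
    have sub: "disc_interior ?k \<subseteq> topspace (disc ?k)" by (auto simp: disc_interior_def)
    show "inj_on ?\<phi> (disc_interior ?k)"
    proof (rule comp_inj_on)
      show "inj_on (disc_to_cube ?k) (disc_interior ?k)" using id sub by (rule inj_on_subset)
      show "inj_on (cube_map n \<sigma>) (disc_to_cube ?k ` disc_interior ?k)"
        by (rule inj_on_subset[OF inj_on_cube_map_open_cube[OF \<sigma>]]) (use disc_to_cube_mem(2) sub in blast)
    qed
    have "open_face ?k {} {} \<subseteq> topspace (cube_of n \<sigma>)" by (auto simp: mem_open_face_empty)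
    then show "?c \<subseteq> ?\<phi> ` topspace (disc ?k)"
      unfolding image_comp[symmetric] sd using cube_map_open_cube[OF \<sigma>] by blast
  qed
  show "?\<phi> ` disc_boundary ?k \<subseteq> (\<Union>j<?k. \<Union>(?K j))"
  proof
    fix y assume "y \<in> ?\<phi> ` disc_boundary ?k"
    then obtain x where x: "x \<in> topspace (disc ?k)" "x \<notin> disc_interior ?k" "y = ?\<phi> x"
      by (auto simp: disc_boundary_eq)
    then show "y \<in> (\<Union>j<?k. \<Union>(?K j))"
      using cube_map_boundary[OF \<sigma> disc_to_cube_mem(1)[OF x(1)]] disc_to_cube_mem(2)[OF x(1)]
      by simp
  qed
qed

text \<open>
  As there are finitely many cells, closure-finiteness is clear and the weak topology is no restriction: a set is the
  finite union of its intersections with the closures of the cells.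
\<close>

lemma cw_complex_uncrowded_conf: "cw_complex (uncrowded_conf n) (product_cells n)"
  unfolding cw_complex_def
proof (intro conjI allI impI ballI)
  let ?X = "uncrowded_conf n" and ?K = "product_cells n"
  show "Hausdorff_space ?X" by (rule Hausdorff_uncrowded_conf)
  show U: "(\<Union>k. \<Union>(?K k)) = topspace ?X"
    by (auto simp: Union_product_cells topspace_uncrowded_conf)
  show "disjoint_family_on snd (SIGMA k:UNIV. ?K k)"
    unfolding disjoint_family_on_def
  proof (intro ballI impI)
    fix p q assume p: "p \<in> (SIGMA k:UNIV. ?K k)" and q: "q \<in> (SIGMA k:UNIV. ?K k)" and "p \<noteq> q"
    obtain \<sigma> where \<sigma>: "\<sigma> \<in> labels n" "p = (label_dim n \<sigma>, PiE {..<n} \<sigma>)"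
      using p by (auto simp: product_cells_def)
    obtain \<tau> where \<tau>: "\<tau> \<in> labels n" "q = (label_dim n \<tau>, PiE {..<n} \<tau>)"
      using q by (auto simp: product_cells_def)
    have "\<sigma> \<noteq> \<tau>" using \<sigma> \<tau> \<open>p \<noteq> q\<close> by blast
    then show "snd p \<inter> snd q = {}"
      using label_unique[OF \<sigma>(1) \<tau>(1)] \<sigma>(2) \<tau>(2) by (auto simp del: PiE_iff)
  qed
  show "\<exists>\<phi>. characteristic_map ?X ?K k c \<phi>" if "c \<in> ?K k" for k c
    using that characteristic_map_cube_map by (auto simp: product_cells_def)
  have K: "(\<Union>k. ?K k) = PiE {..<n} ` labels n"
    by (auto simp: product_cells_def)
  have fin: "finite (\<Union>k. ?K k)"
    unfolding K by (intro finite_imageI finite_labels)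
  show "\<exists>F. finite F \<and> F \<subseteq> (\<Union>j. ?K j) \<and> ?X closure_of c \<subseteq> \<Union>F" if "c \<in> ?K k" for k c
  proof (intro exI conjI)
    show "?X closure_of c \<subseteq> \<Union>(\<Union>j. ?K j)"
      using closure_of_subset_topspace[of ?X c] U by blast
  qed (rule fin, rule order_refl)
  show "closedin ?X A" if A: "A \<subseteq> topspace ?X"
    and cl: "\<forall>k. \<forall>c\<in>?K k. closedin (subtopology ?X (?X closure_of c)) (A \<inter> ?X closure_of c)" for A
  proof -
    have "closedin ?X (A \<inter> ?X closure_of c)" if "c \<in> (\<Union>k. ?K k)" for c
      using that cl closedin_trans_full closedin_closure_of by blast
    then have "closedin ?X (\<Union>c\<in>(\<Union>k. ?K k). A \<inter> ?X closure_of c)"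
      using fin by (intro closedin_Union) auto
    moreover have "(\<Union>c\<in>(\<Union>k. ?K k). A \<inter> ?X closure_of c) = A"
    proof (intro equalityI subsetI)
      fix x assume x: "x \<in> A"
      then obtain c where c: "c \<in> (\<Union>k. ?K k)" "x \<in> c" using A U by blast
      then have "c \<subseteq> topspace ?X" using U by blast
      then have "x \<in> ?X closure_of c" using closure_of_subset[of c ?X] c by blast
      then show "x \<in> (\<Union>c\<in>(\<Union>k. ?K k). A \<inter> ?X closure_of c)" using x c by blast
    qed auto
    ultimately show ?thesis by simp
  qed
qed

lemma cw_dim_le_product_cells: "cw_dim_le (product_cells n) (card E)"
  using label_dim_le by (fastforce simp: cw_dim_le_def product_cells_def)

end

section \<open>Edges of a tree\<close>

text \<open>
  The values lie in \<open>2\<pi>\<i>\<int>\<close>, so two distinct ones have distance at least \<open>2\<pi>\<close>.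
\<close>

lemma exp_eq_1_imp_constant:
  fixes f :: "real \<Rightarrow> complex"
  assumes f: "continuous_on {0..1} f" "\<And>t. t \<in> {0..1} \<Longrightarrow> exp (f t) = 1"
    and st: "s \<in> {0..1}" "t \<in> {0..1}"
  shows "f s = f t"
proof -
  have "f constant_on {0..1}"
  proof (rule continuous_discrete_range_constant[OF _ f(1)])
    fix x :: real assume x: "x \<in> {0..1}"
    have "2 * pi \<le> norm (f y - f x)" if y: "y \<in> {0..1}" "f y \<noteq> f x" for y
    proof -
      have "exp (f y) = exp (f x)" using x y f(2) by simp
      then obtain k :: int where k: "f y = f x + of_int (2 * k) * pi * \<i>"
        unfolding exp_eq by auto
      then have "k \<noteq> 0" using y by auto
      then have "1 \<le> \<bar>real_of_int k\<bar>" by linarith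
      then have "2 * pi * 1 \<le> 2 * pi * \<bar>real_of_int k\<bar>" by (intro mult_left_mono) auto
      also have "\<dots> = norm (f y - f x)" using k by (simp add: norm_mult)
      finally show ?thesis by simp
    qed
    then show "\<exists>e>0. \<forall>y. y \<in> {0..1} \<and> f y \<noteq> f x \<longrightarrow> e \<le> norm (f y - f x)"
      by (intro exI[of _ "2 * pi"]) auto
  qed simp
  then show ?thesis using st by (auto simp: constant_on_def)
qed

lemma log_change_unique:
  fixes a b :: "real \<Rightarrow> complex"
  assumes "continuous_on {0..1} a" "continuous_on {0..1} b" "\<And>t. t \<in> {0..1} \<Longrightarrow> exp (a t) = exp (b t)"
  shows "a 1 - a 0 = b 1 - b 0"
proof -
  have "a 1 - b 1 = a 0 - b 0"
    by (rule exp_eq_1_imp_constant[where f = "\<lambda>t. a t - b t"])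
      (use assms in \<open>auto simp: exp_diff intro!: continuous_intros\<close>)
  then show ?thesis by (simp add: algebra_simps)
qed

text \<open>
  A contraction \<open>H\<close> moves both paths simultaneously. The two paths moved to time \<open>t\<close> still have common
  ends, so the difference \<open>\<delta> t\<close> of the changes of the logarithm along them is a multiple of \<open>2\<pi>\<i>\<close> and
  does not depend on \<open>t\<close>. At time 1 both paths are constant and \<open>\<delta> 1 = 0\<close>. The logarithms exist
  because the square \<open>[0, 1] \<times> [0, 1]\<close> is contractible.
\<close>

lemma contractible_space_log_change:
  fixes q :: "'a \<Rightarrow> complex" and a a' :: "real \<Rightarrow> complex"
  assumes contr: "contractible_space X"
    and q: "continuous_map X euclidean q" "\<And>p. p \<in> topspace X \<Longrightarrow> q p \<noteq> 0"
    and \<phi>: "continuous_map (top_of_set {0..1}) X \<phi>" and \<phi>': "continuous_map (top_of_set {0..1}) X \<phi>'"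
    and ends: "\<phi> 0 = \<phi>' 0" "\<phi> 1 = \<phi>' 1"
    and a: "continuous_on {0..1} a" "\<And>t. t \<in> {0..1} \<Longrightarrow> exp (a t) = q (\<phi> t)"
    and a': "continuous_on {0..1} a'" "\<And>t. t \<in> {0..1} \<Longrightarrow> exp (a' t) = q (\<phi>' t)"
  shows "a 1 - a 0 = a' 1 - a' 0"
proof -
  obtain c where "homotopic_with (\<lambda>x. True) X X id (\<lambda>x. c)"
    using contr unfolding contractible_space_def by blast
  then obtain H where H: "continuous_map (prod_topology (top_of_set {0..1::real}) X) X H"
    and H0: "\<And>x. H (0, x) = x" and H1: "\<And>x. H (1, x) = c"
    unfolding homotopic_with_def by auto
  have log: "\<exists>L. continuous_on ({0..1} \<times> {0..1}) L \<and>
      (\<forall>t\<in>{0..1}. \<forall>s\<in>{0..1}. q (H (t, \<psi> s)) = exp (L (t, s)))"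
    if \<psi>: "continuous_map (top_of_set {0..1}) X \<psi>" for \<psi> :: "real \<Rightarrow> 'a"
  proof -
    let ?Q = "prod_topology (top_of_set {0..1::real}) (top_of_set {0..1::real})"
    have "continuous_map ?Q X (\<psi> \<circ> snd)"
      using continuous_map_snd \<psi> by (rule continuous_map_compose)
    then have "continuous_map ?Q (prod_topology (top_of_set {0..1::real}) X) (\<lambda>z. (fst z, (\<psi> \<circ> snd) z))"
      using continuous_map_fst[of "top_of_set {0..1::real}" "top_of_set {0..1::real}"]
      unfolding continuous_map_pairwise by (simp only: o_def fst_conv snd_conv)
    from continuous_map_compose[OF this H]
    have HQ: "continuous_map ?Q X (\<lambda>z. H (fst z, \<psi> (snd z)))" by (simp add: o_def)
    from continuous_map_compose[OF this q(1)]
    have c: "continuous_on ({0..1} \<times> {0..1}) (\<lambda>z. q (H (fst z, \<psi> (snd z))))"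
      by (simp add: o_def prod_topology_subtopology_eu)
    have "q (H (fst z, \<psi> (snd z))) \<noteq> 0" if "z \<in> {0..1} \<times> {0..1}" for z
      using continuous_map_image_subset_topspace[OF HQ] that q(2) by auto
    then obtain L where "continuous_on ({0..1} \<times> {0..1}) L"
      "\<And>z. z \<in> {0..1} \<times> {0..1} \<Longrightarrow> q (H (fst z, \<psi> (snd z))) = exp (L z)"
      using continuous_logarithm_on_contractible[OF c] convex_imp_contractible convex_Times
      by (metis convex_real_interval(5))
    then show ?thesis by (intro exI[of _ L]) force
  qed
  from log[OF \<phi>] obtain L where L: "continuous_on ({0..1} \<times> {0..1}) L"
    "\<And>t s. t \<in> {0..1} \<Longrightarrow> s \<in> {0..1} \<Longrightarrow> q (H (t, \<phi> s)) = exp (L (t, s))" by blast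
  from log[OF \<phi>'] obtain L' where L': "continuous_on ({0..1} \<times> {0..1}) L'"
    "\<And>t s. t \<in> {0..1} \<Longrightarrow> s \<in> {0..1} \<Longrightarrow> q (H (t, \<phi>' s)) = exp (L' (t, s))" by blast
  have slice: "continuous_on {0..1} (\<lambda>s. M (t, s))" "continuous_on {0..1} (\<lambda>s. M (s, t))"
    if "continuous_on ({0..1} \<times> {0..1}) M" "t \<in> {0..1}" for M :: "real \<times> real \<Rightarrow> complex" and t
    using that by (auto intro!: continuous_on_compose2[OF that(1)] continuous_intros)
  define \<delta> where "\<delta> = (\<lambda>t. (L (t, 1) - L (t, 0)) - (L' (t, 1) - L' (t, 0)))"
  have "\<delta> 0 = \<delta> 1"
  proof (rule exp_eq_1_imp_constant)
    show "continuous_on {0..1} \<delta>"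
      unfolding \<delta>_def by (intro continuous_intros slice L(1) L'(1)) auto
    fix t :: real assume t: "t \<in> {0..1}"
    have "exp (L (t, 1)) = exp (L' (t, 1))" "exp (L (t, 0)) = exp (L' (t, 0))"
      using L(2)[OF t, of 0] L(2)[OF t, of 1] L'(2)[OF t, of 0] L'(2)[OF t, of 1] ends by auto
    then show "exp (\<delta> t) = 1" by (simp add: \<delta>_def exp_diff)
  qed auto
  moreover have "L (1, 1) - L (1, 0) = 0 - 0" "L' (1, 1) - L' (1, 0) = 0 - 0"
  proof -
    have *: "M (1, 1) - M (1, 0) = 0 - 0"
      if M: "continuous_on ({0..1} \<times> {0..1}) M" "\<And>s. s \<in> {0..1} \<Longrightarrow> exp (M (1, s)) = q c"
      for M :: "real \<times> real \<Rightarrow> complex"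
    proof -
      have "M (1, 1) - M (1, 0) = M (1, 0) - M (1, 0)"
        by (rule log_change_unique[where a = "\<lambda>s. M (1, s)" and b = "\<lambda>s. M (1, 0)"])
          (use M slice in auto)
      then show ?thesis by simp
    qed
    show "L (1, 1) - L (1, 0) = 0 - 0" "L' (1, 1) - L' (1, 0) = 0 - 0"
      using L(2)[of 1] L'(2)[of 1] H1 by (auto intro!: *[OF L(1), simplified] *[OF L'(1), simplified])
  qed
  ultimately have "L (0, 1) - L (0, 0) = L' (0, 1) - L' (0, 0)" by (simp add: \<delta>_def)
  moreover have "a 1 - a 0 = L (0, 1) - L (0, 0)"
    by (rule log_change_unique[where b = "\<lambda>s. L (0, s)"])
      (use a slice(1)[OF L(1)] L(2)[of 0] H0 in auto)
  moreover have "a' 1 - a' 0 = L' (0, 1) - L' (0, 0)"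
    by (rule log_change_unique[where b = "\<lambda>s. L' (0, s)"])
      (use a' slice(1)[OF L'(1)] L'(2)[of 0] H0 in auto)
  ultimately show ?thesis by simp
qed

context param_graph
begin

text \<open>
  Collapse the complement of \<open>e\<close> to a point and wrap \<open>e\<close> once around the unit circle. The logarithm of this
  map changes by \<open>2\<pi>\<i>\<close> along \<open>e\<close>, but not along a path outside \<open>e\<close> with the same ends.
\<close>

lemma tree_no_bypass:
  fixes \<phi> :: "real \<Rightarrow> 'a"
  assumes contr: "contractible_space G" and e: "e \<in> E"
    and \<phi>: "continuous_map (top_of_set {0..1}) G \<phi>" "\<phi> 0 = \<gamma> e 0" "\<phi> 1 = \<gamma> e 1"
    and off: "\<And>t. t \<in> {0..1} \<Longrightarrow> \<phi> t \<notin> e"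
  shows False
proof -
  \<comment> \<open>The lift of the loop around the circle.\<close>
  define a where "a = (\<lambda>t. 2 * pi * \<i> * complex_of_real t)"
  define q where "q = (\<lambda>p. if p \<in> e then exp (a (coord e p)) else 1)"
  have a: "continuous_on {0..1} a" by (auto simp: a_def intro!: continuous_intros)
  have a01: "exp (a 0) = 1" "exp (a 1) = 1" by (auto simp: a_def)
  have "continuous_map (top_of_set {0..1}) euclidean (\<lambda>t. exp (a t))"
    using a by (auto intro!: continuous_intros)
  then have q: "continuous_map G euclidean q"
    unfolding q_def by (rule continuous_map_edge_collapse[OF e]) (use a01 in auto)
  have "exp (a t) = q (\<gamma> e t)" if t: "t \<in> {0..1}" for t
  proof (cases "0 < t \<and> t < 1")
    case True
    then show ?thesis using t e by (simp add: q_def edge_mem_iff coord_edge)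
  next
    case False
    then have "t = 0 \<or> t = 1" "\<gamma> e t \<notin> e" using t e edge_mem_iff[of e t] by auto
    then show ?thesis using a01 by (auto simp: q_def)
  qed
  moreover have "exp 0 = q (\<phi> t)" if "t \<in> {0..1}" for t using off[OF that] by (simp add: q_def)
  ultimately have "a 1 - a 0 = (\<lambda>_. 0) 1 - (\<lambda>_. 0) (0::real)"
    by (intro contractible_space_log_change[where \<phi> = "\<gamma> e" and \<phi>' = \<phi> and a = a and a' = "\<lambda>_. 0", OF contr q])
      (use a continuous_edge[OF e] \<phi> in \<open>auto simp: q_def\<close>)
  then show False by (simp add: a_def)
qed

lemma tree_edge_ends_distinct:
  assumes "contractible_space G" "e \<in> E"
  shows "\<gamma> e 0 \<noteq> \<gamma> e 1"
proof
  assume "\<gamma> e 0 = \<gamma> e 1"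
  then show False
    using tree_no_bypass[OF assms, of "\<lambda>_. \<gamma> e 0"] edge_in_topspace[OF assms(2), of 0]
      edge_ends[OF assms(2)] vertex_notin_edge[OF _ assms(2)]
    by auto
qed

text \<open>
  The edge \<open>e'\<close>, run through in one of its two directions, would bypass \<open>e\<close>.
\<close>

lemma tree_edges_not_parallel:
  assumes contr: "contractible_space G" and e: "e \<in> E" "e' \<in> E" "e \<noteq> e'"
    and eq: "\<gamma> e' s = \<gamma> e 0" "\<gamma> e' t = \<gamma> e 1" and st: "s = 0 \<and> t = 1 \<or> s = 1 \<and> t = 0"
  shows False
proof (rule tree_no_bypass[OF contr e(1)])
  let ?\<phi> = "\<lambda>r. \<gamma> e' (s + r * (t - s))"
  have "continuous_map (top_of_set {0..1}) (top_of_set {0..1}) (\<lambda>r. s + r * (t - s))"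
    using st by (auto intro!: continuous_intros)
  from continuous_map_compose[OF this continuous_edge[OF e(2)]]
  show "continuous_map (top_of_set {0..1}) G ?\<phi>" by (simp add: o_def)
  show "?\<phi> 0 = \<gamma> e 0" "?\<phi> 1 = \<gamma> e 1" using eq by auto
  fix r :: real assume "r \<in> {0..1}"
  then have u: "0 \<le> s + r * (t - s)" "s + r * (t - s) \<le> 1" using st by auto
  have "?\<phi> r \<in> V \<union> e'"
  proof (cases "0 < s + r * (t - s) \<and> s + r * (t - s) < 1")
    case False
    then have "s + r * (t - s) = 0 \<or> s + r * (t - s) = 1" using u by linarith
    then show ?thesis using edge_ends[OF e(2)] by (elim disjE) simp_all
  qed (simp add: edge_mem_iff[OF e(2) u])
  then show "?\<phi> r \<notin> e" using vertex_notin_edge e edges_disjoint by blast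
qed

lemma tree_edge_inj:
  assumes contr: "contractible_space G" and e: "e \<in> E"
    and st: "0 \<le> s" "s \<le> 1" "0 \<le> t" "t \<le> 1" and eq: "\<gamma> e s = \<gamma> e t"
  shows "s = t"
proof (cases "0 < s \<and> s < 1")
  case True
  then have "\<gamma> e s \<in> e" using edge_mem_iff[OF e st(1,2)] by simp
  then have "0 < t \<and> t < 1" using eq edge_mem_iff[OF e st(3,4)] by simp
  then have "coord e (\<gamma> e t) = t" using coord_edge[OF e] by blast
  moreover have "coord e (\<gamma> e s) = s" using True coord_edge[OF e] by blast
  ultimately show ?thesis using eq by simp
next
  case False
  then have "\<gamma> e t \<notin> e" using eq edge_mem_iff[OF e st(1,2)] by simp
  then have "\<not> (0 < t \<and> t < 1)" using edge_mem_iff[OF e st(3,4)] by simp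
  then have "(s = 0 \<or> s = 1) \<and> (t = 0 \<or> t = 1)" using False st by auto
  then show ?thesis using tree_edge_ends_distinct[OF contr e] eq by auto
qed

lemma distinct_cells_meet_at_end:
  assumes c: "c \<in> cells" "c' \<in> cells" "c \<noteq> c'" "c \<in> E"
    and s: "0 \<le> s" "s \<le> 1" and t: "0 \<le> t" "t \<le> 1"
    and eq: "cell_param c s = cell_param c' t"
  shows "s = 0 \<or> s = 1"
proof (rule ccontr)
  assume "\<not> (s = 0 \<or> s = 1)"
  then have "cell_param c s \<in> c" using cell_param_mem_iff[OF c(1) s] s by auto
  then have "c' = c" using cell_param_mem_other_edge[OF c(2) t c(4)] eq by simp
  then show False using c(3) by simp
qed

lemma tree_cells_meet_once:
  assumes contr: "contractible_space G" and c: "c \<in> cells" "c' \<in> cells" "c \<noteq> c'" "c \<in> E"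
    and s: "0 \<le> s" "s \<le> 1" and t: "0 \<le> t" "t \<le> 1" and eq: "cell_param c s = cell_param c' t"
    and s': "0 \<le> s'" "s' \<le> 1" and t': "0 \<le> t'" "t' \<le> 1" and eq': "cell_param c s' = cell_param c' t'"
  shows "s = s'"
proof (cases "c' \<in> E")
  case True
  show ?thesis
  proof (rule ccontr)
    assume ne: "s \<noteq> s'"
    have s01: "s = 0 \<or> s = 1" "s' = 0 \<or> s' = 1"
      using distinct_cells_meet_at_end[OF c s t eq] distinct_cells_meet_at_end[OF c s' t' eq'] by auto
    have t01: "t = 0 \<or> t = 1" "t' = 0 \<or> t' = 1"
      using distinct_cells_meet_at_end[OF c(2,1) c(3)[symmetric] True t s eq[symmetric]]
        distinct_cells_meet_at_end[OF c(2,1) c(3)[symmetric] True t' s' eq'[symmetric]] by auto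
    have eqs: "\<gamma> c' t = \<gamma> c s" "\<gamma> c' t' = \<gamma> c s'" using eq eq' c(4) True by (auto simp: cell_param_def)
    have "t \<noteq> t'" using eqs ne tree_edge_inj[OF contr c(4) s s'] by auto
    then show False
      using tree_edges_not_parallel[OF contr c(4) True c(3), of t t']
        tree_edges_not_parallel[OF contr c(4) True c(3), of t' t] eqs ne s01 t01 by auto
  qed
next
  case False
  then have "\<gamma> c s = \<gamma> c s'" using eq eq' c(4) by (simp add: cell_param_def)
  then show ?thesis using tree_edge_inj[OF contr c(4) s s'] by simp
qed

section \<open>The cubical structure for a tree\<close>

text \<open>
  Let \<open>x0\<close> be a point of the cube of \<open>\<sigma>\<close> that is identified with a point of the cube of \<open>\<tau>\<close>. In a factor where \<open>\<sigma>\<close> and \<open>\<tau>\<close>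
  differ, the two closed cells have only one point in common, so there all points of the intersection have the
  same coordinate as \<open>x0\<close>; in the other factors there is no restriction.
\<close>

definition matching_face :: "nat \<Rightarrow> (nat \<Rightarrow> 'a set) \<Rightarrow> (nat \<Rightarrow> 'a set) \<Rightarrow> (nat \<Rightarrow> real) \<Rightarrow> (nat \<Rightarrow> real) set" where
  "matching_face n \<sigma> \<tau> x0 =
     {x \<in> topspace (cube_of n \<sigma>).
        \<forall>i\<in>edge_positions n \<sigma>. \<sigma> i \<noteq> \<tau> i \<longrightarrow> x (slot n \<sigma> i) = x0 (slot n \<sigma> i)}"

text \<open>
  The gluing map from the matching face of \<open>\<sigma>\<close> to that of \<open>\<tau>\<close>: coordinates of common factors are kept, and the
  others are those of the base point \<open>y0\<close>.
\<close>

definition transfer :: "nat \<Rightarrow> (nat \<Rightarrow> 'a set) \<Rightarrow> (nat \<Rightarrow> 'a set) \<Rightarrow> (nat \<Rightarrow> real) \<Rightarrow> (nat \<Rightarrow> real) \<Rightarrow> nat \<Rightarrow> real" where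
  "transfer n \<sigma> \<tau> y0 x = (\<lambda>m. if m < label_dim n \<tau> then
     (let i = slot_position n \<tau> m in if \<sigma> i = \<tau> i then x (slot n \<sigma> i) else y0 m) else 0)"

lemma transfer_slot:
  "i \<in> edge_positions n \<tau> \<Longrightarrow>
    transfer n \<sigma> \<tau> y0 x (slot n \<tau> i) = (if \<sigma> i = \<tau> i then x (slot n \<sigma> i) else y0 (slot n \<tau> i))"
  by (simp add: transfer_def slot_less slot_position_slot)

lemma cube_eqI:
  assumes "x \<in> topspace (cube_of n \<sigma>)" "y \<in> topspace (cube_of n \<sigma>)"
    "\<And>i. i \<in> edge_positions n \<sigma> \<Longrightarrow> x (slot n \<sigma> i) = y (slot n \<sigma> i)"
  shows "x = y"
proof
  fix m
  show "x m = y m"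
  proof (cases "m < label_dim n \<sigma>")
    case True
    then show ?thesis using assms(3)[of "slot_position n \<sigma> m"] slot_position[OF True] by simp
  next
    case False
    then show ?thesis using assms by (simp add: topspace_unit_cube)
  qed
qed

lemma transfer_mem:
  assumes "x \<in> topspace (cube_of n \<sigma>)" "y0 \<in> topspace (cube_of n \<tau>)"
  shows "transfer n \<sigma> \<tau> y0 x \<in> matching_face n \<tau> \<sigma> y0"
proof -
  have "0 \<le> transfer n \<sigma> \<tau> y0 x m \<and> transfer n \<sigma> \<tau> y0 x m \<le> 1" for m
    using unit_cube_nonneg_le_1[OF assms(1)] unit_cube_nonneg_le_1[OF assms(2)]
    by (auto simp: transfer_def Let_def)
  moreover have "transfer n \<sigma> \<tau> y0 x m = 0" if "label_dim n \<tau> \<le> m" for m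
    using that by (simp add: transfer_def)
  ultimately have "transfer n \<sigma> \<tau> y0 x \<in> topspace (cube_of n \<tau>)" by (simp add: topspace_unit_cube)
  then show ?thesis by (auto simp: matching_face_def transfer_slot)
qed

lemma matching_face_eqI:
  assumes "x \<in> matching_face n \<sigma> \<tau> x0" "y \<in> matching_face n \<sigma> \<tau> x0"
    "\<And>i. i \<in> edge_positions n \<sigma> \<Longrightarrow> \<sigma> i = \<tau> i \<Longrightarrow> x (slot n \<sigma> i) = y (slot n \<sigma> i)"
  shows "x = y"
  by (rule cube_eqI[of _ n \<sigma>]) (use assms in \<open>force simp: matching_face_def\<close>)+

lemma transfer_transfer:
  assumes x: "x \<in> matching_face n \<sigma> \<tau> x0" and x0: "x0 \<in> topspace (cube_of n \<sigma>)"
    and y0: "y0 \<in> topspace (cube_of n \<tau>)"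
  shows "transfer n \<tau> \<sigma> x0 (transfer n \<sigma> \<tau> y0 x) = x"
proof (rule matching_face_eqI[OF _ x])
  have "x \<in> topspace (cube_of n \<sigma>)" using x by (simp add: matching_face_def)
  from transfer_mem[OF this y0] have "transfer n \<sigma> \<tau> y0 x \<in> topspace (cube_of n \<tau>)"
    by (simp add: matching_face_def)
  from transfer_mem[OF this x0]
  show "transfer n \<tau> \<sigma> x0 (transfer n \<sigma> \<tau> y0 x) \<in> matching_face n \<sigma> \<tau> x0" .
  fix i assume i: "i \<in> edge_positions n \<sigma>" "\<sigma> i = \<tau> i"
  then have "i \<in> edge_positions n \<tau>" by (simp add: edge_positions_def)
  then show "transfer n \<tau> \<sigma> x0 (transfer n \<sigma> \<tau> y0 x) (slot n \<sigma> i) = x (slot n \<sigma> i)"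
    using i by (simp add: transfer_slot)
qed

lemma sum_slots: "(\<Sum>m<label_dim n \<sigma>. f m) = (\<Sum>i\<in>edge_positions n \<sigma>. f (slot n \<sigma> i))"
  using sum.reindex_bij_betw[OF bij_slot, of f n \<sigma>] by simp

text \<open>
  Two points of the matching face differ only in the coordinates that belong to common factors, and the
  transfer just permutes these.
\<close>

lemma face_isometry_transfer:
  assumes x0: "x0 \<in> topspace (cube_of n \<sigma>)" and y0: "y0 \<in> topspace (cube_of n \<tau>)"
  shows "face_isometry (label_dim n \<sigma>) (matching_face n \<sigma> \<tau> x0)
    (label_dim n \<tau>) (matching_face n \<tau> \<sigma> y0) (transfer n \<sigma> \<tau> y0)"
  unfolding face_isometry_def
proof (intro conjI ballI)
  show "bij_betw (transfer n \<sigma> \<tau> y0) (matching_face n \<sigma> \<tau> x0) (matching_face n \<tau> \<sigma> y0)"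
  proof (rule bij_betw_byWitness[where f' = "transfer n \<tau> \<sigma> x0"])
    show "\<forall>x\<in>matching_face n \<sigma> \<tau> x0. transfer n \<tau> \<sigma> x0 (transfer n \<sigma> \<tau> y0 x) = x"
      using transfer_transfer x0 y0 by blast
    show "\<forall>y\<in>matching_face n \<tau> \<sigma> y0. transfer n \<sigma> \<tau> y0 (transfer n \<tau> \<sigma> x0 y) = y"
      using transfer_transfer x0 y0 by blast
    show "transfer n \<sigma> \<tau> y0 ` matching_face n \<sigma> \<tau> x0 \<subseteq> matching_face n \<tau> \<sigma> y0"
      using transfer_mem[OF _ y0] by (auto simp: matching_face_def)
    show "transfer n \<tau> \<sigma> x0 ` matching_face n \<tau> \<sigma> y0 \<subseteq> matching_face n \<sigma> \<tau> x0"
      using transfer_mem[OF _ x0] by (auto simp: matching_face_def)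
  qed
  fix x y assume x: "x \<in> matching_face n \<sigma> \<tau> x0" and y: "y \<in> matching_face n \<sigma> \<tau> x0"
  let ?h = "transfer n \<sigma> \<tau> y0" and ?D = "{i. i < n \<and> \<sigma> i \<in> E \<and> \<sigma> i = \<tau> i}"
  let ?d = "\<lambda>i. (x (slot n \<sigma> i) - y (slot n \<sigma> i))\<^sup>2"
  have "(\<Sum>m<label_dim n \<tau>. (?h x m - ?h y m)\<^sup>2)
      = (\<Sum>i\<in>edge_positions n \<tau>. (?h x (slot n \<tau> i) - ?h y (slot n \<tau> i))\<^sup>2)"
    by (rule sum_slots)
  also have "\<dots> = sum ?d ?D"
  proof (rule sum.mono_neutral_cong_right[OF finite_edge_positions])
    show "?D \<subseteq> edge_positions n \<tau>" by (auto simp: edge_positions_def)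
    show "\<forall>i\<in>edge_positions n \<tau> - ?D. (?h x (slot n \<tau> i) - ?h y (slot n \<tau> i))\<^sup>2 = 0"
    proof
      fix i assume "i \<in> edge_positions n \<tau> - ?D"
      then have "i \<in> edge_positions n \<tau>" "\<sigma> i \<noteq> \<tau> i" by (auto simp: edge_positions_def)
      then show "(?h x (slot n \<tau> i) - ?h y (slot n \<tau> i))\<^sup>2 = 0" by (simp add: transfer_slot)
    qed
    show "(?h x (slot n \<tau> i) - ?h y (slot n \<tau> i))\<^sup>2 = ?d i" if "i \<in> ?D" for i
    proof -
      have "i \<in> edge_positions n \<tau>" "\<sigma> i = \<tau> i" using that by (auto simp: edge_positions_def)
      then show ?thesis by (simp add: transfer_slot)
    qed
  qed
  also have "\<dots> = (\<Sum>i\<in>edge_positions n \<sigma>. ?d i)"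
  proof (rule sum.mono_neutral_left[OF finite_edge_positions])
    show "?D \<subseteq> edge_positions n \<sigma>" by (auto simp: edge_positions_def)
    show "\<forall>i\<in>edge_positions n \<sigma> - ?D. ?d i = 0"
    proof
      fix i assume "i \<in> edge_positions n \<sigma> - ?D"
      then have "i \<in> edge_positions n \<sigma>" "\<sigma> i \<noteq> \<tau> i" by (auto simp: edge_positions_def)
      then show "?d i = 0" using x y by (simp add: matching_face_def)
    qed
  qed
  also have "\<dots> = (\<Sum>m<label_dim n \<sigma>. (x m - y m)\<^sup>2)"
    by (rule sum_slots[symmetric])
  finally show "L2_set (\<lambda>i. ?h x i - ?h y i) {..<label_dim n \<tau>} = L2_set (\<lambda>i. x i - y i) {..<label_dim n \<sigma>}"
    by (simp add: L2_set_def)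
qed

lemma cube_map_eq_iff:
  "cube_map n \<sigma> x = cube_map n \<tau> y \<longleftrightarrow>
    (\<forall>i<n. cell_param (\<sigma> i) (x (slot n \<sigma> i)) = cell_param (\<tau> i) (y (slot n \<tau> i)))"
  unfolding cube_map_def fun_eq_iff by auto

text \<open>
  Distinct closed cells meet in vertices, so the coordinates of \<open>x0\<close> that are prescribed are 0 or 1.
\<close>

lemma is_face_matching_face:
  assumes \<sigma>: "\<sigma> \<in> labels n" and \<tau>: "\<tau> \<in> labels n"
    and x0: "x0 \<in> topspace (cube_of n \<sigma>)" and y0: "y0 \<in> topspace (cube_of n \<tau>)"
    and eq: "cube_map n \<sigma> x0 = cube_map n \<tau> y0"
  shows "is_face (label_dim n \<sigma>) (matching_face n \<sigma> \<tau> x0)"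
proof -
  define F where "F = (\<lambda>r. slot n \<sigma> ` {i \<in> edge_positions n \<sigma>. \<sigma> i \<noteq> \<tau> i \<and> x0 (slot n \<sigma> i) = (r::real)})"
  have end01: "x0 (slot n \<sigma> i) = 0 \<or> x0 (slot n \<sigma> i) = 1"
    if "i \<in> edge_positions n \<sigma>" "\<sigma> i \<noteq> \<tau> i" for i
    using that eq unit_cube_nonneg_le_1[OF x0] unit_cube_nonneg_le_1[OF y0]
      distinct_cells_meet_at_end[OF label_cell[OF \<sigma>] label_cell[OF \<tau>], of i i "x0 (slot n \<sigma> i)" "y0 (slot n \<tau> i)"]
    by (auto simp: edge_positions_def cube_map_eq_iff)
  have "face_index (label_dim n \<sigma>) (F 0) (F 1)"
    by (auto simp: face_index_def F_def slot_less)
  moreover have "matching_face n \<sigma> \<tau> x0 = closed_face (label_dim n \<sigma>) (F 0) (F 1)"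
  proof (intro equalityI subsetI)
    fix x assume "x \<in> matching_face n \<sigma> \<tau> x0"
    then show "x \<in> closed_face (label_dim n \<sigma>) (F 0) (F 1)"
      by (auto simp: matching_face_def closed_face_def F_def)
  next
    fix x assume x: "x \<in> closed_face (label_dim n \<sigma>) (F 0) (F 1)"
    have "x (slot n \<sigma> i) = x0 (slot n \<sigma> i)" if i: "i \<in> edge_positions n \<sigma>" "\<sigma> i \<noteq> \<tau> i" for i
    proof -
      have "slot n \<sigma> i \<in> F (x0 (slot n \<sigma> i))" using i by (auto simp: F_def)
      then show ?thesis using end01[OF i] x by (auto simp: closed_face_def)
    qed
    then show "x \<in> matching_face n \<sigma> \<tau> x0" using x by (simp add: matching_face_def closed_face_def)
  qed
  ultimately show ?thesis unfolding is_face_def by blast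
qed

lemma tree_cube_map_eq_iff:
  assumes contr: "contractible_space G" and \<sigma>: "\<sigma> \<in> labels n" and \<tau>: "\<tau> \<in> labels n"
    and x0: "x0 \<in> topspace (cube_of n \<sigma>)" and y0: "y0 \<in> topspace (cube_of n \<tau>)"
    and eq: "cube_map n \<sigma> x0 = cube_map n \<tau> y0"
    and x: "x \<in> topspace (cube_of n \<sigma>)" and y: "y \<in> topspace (cube_of n \<tau>)"
  shows "cube_map n \<sigma> x = cube_map n \<tau> y \<longleftrightarrow>
    x \<in> matching_face n \<sigma> \<tau> x0 \<and> y \<in> matching_face n \<tau> \<sigma> y0 \<and> y = transfer n \<sigma> \<tau> y0 x"
proof
  assume eqxy: "cube_map n \<sigma> x = cube_map n \<tau> y"
  have e: "cell_param (\<sigma> i) (x (slot n \<sigma> i)) = cell_param (\<tau> i) (y (slot n \<tau> i))"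
    and e0: "cell_param (\<sigma> i) (x0 (slot n \<sigma> i)) = cell_param (\<tau> i) (y0 (slot n \<tau> i))" if "i < n" for i
    using eqxy eq that by (auto simp: cube_map_eq_iff)
  note bounds = unit_cube_nonneg_le_1[OF x, THEN conjunct1] unit_cube_nonneg_le_1[OF x, THEN conjunct2]
    unit_cube_nonneg_le_1[OF y, THEN conjunct1] unit_cube_nonneg_le_1[OF y, THEN conjunct2]
    unit_cube_nonneg_le_1[OF x0, THEN conjunct1] unit_cube_nonneg_le_1[OF x0, THEN conjunct2]
    unit_cube_nonneg_le_1[OF y0, THEN conjunct1] unit_cube_nonneg_le_1[OF y0, THEN conjunct2]
  have "x (slot n \<sigma> i) = x0 (slot n \<sigma> i)" if "i \<in> edge_positions n \<sigma>" "\<sigma> i \<noteq> \<tau> i" for i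
  proof -
    have i: "i < n" "\<sigma> i \<in> E" using that by (auto simp: edge_positions_def)
    show ?thesis
      by (rule tree_cells_meet_once[OF contr label_cell[OF \<sigma> i(1)] label_cell[OF \<tau> i(1)] that(2) i(2)
            _ _ _ _ e[OF i(1)] _ _ _ _ e0[OF i(1)]]) (rule bounds)+
  qed
  then have xm: "x \<in> matching_face n \<sigma> \<tau> x0" using x by (simp add: matching_face_def)
  have "y (slot n \<tau> i) = y0 (slot n \<tau> i)" if "i \<in> edge_positions n \<tau>" "\<tau> i \<noteq> \<sigma> i" for i
  proof -
    have i: "i < n" "\<tau> i \<in> E" using that by (auto simp: edge_positions_def)
    show ?thesis
      by (rule tree_cells_meet_once[OF contr label_cell[OF \<tau> i(1)] label_cell[OF \<sigma> i(1)] that(2) i(2)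
            _ _ _ _ e[OF i(1), symmetric] _ _ _ _ e0[OF i(1), symmetric]]) (rule bounds)+
  qed
  then have ym: "y \<in> matching_face n \<tau> \<sigma> y0" using y by (simp add: matching_face_def)
  have "y = transfer n \<sigma> \<tau> y0 x"
  proof (rule matching_face_eqI[OF ym transfer_mem[OF x y0]])
    fix i assume i: "i \<in> edge_positions n \<tau>" "\<tau> i = \<sigma> i"
    then have "i < n" "\<tau> i \<in> E" by (auto simp: edge_positions_def)
    then have "\<gamma> (\<tau> i) (y (slot n \<tau> i)) = \<gamma> (\<tau> i) (x (slot n \<sigma> i))"
      using e[of i] i by (simp add: cell_param_def)
    then have "y (slot n \<tau> i) = x (slot n \<sigma> i)"
      by (rule tree_edge_inj[OF contr \<open>\<tau> i \<in> E\<close> bounds(3,4,1,2)])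
    then show "y (slot n \<tau> i) = transfer n \<sigma> \<tau> y0 x (slot n \<tau> i)"
      using i by (simp add: transfer_slot)
  qed
  with xm ym show "x \<in> matching_face n \<sigma> \<tau> x0 \<and> y \<in> matching_face n \<tau> \<sigma> y0 \<and> y = transfer n \<sigma> \<tau> y0 x"
    by blast
next
  assume *: "x \<in> matching_face n \<sigma> \<tau> x0 \<and> y \<in> matching_face n \<tau> \<sigma> y0 \<and> y = transfer n \<sigma> \<tau> y0 x"
  have "cell_param (\<sigma> i) (x (slot n \<sigma> i)) = cell_param (\<tau> i) (y (slot n \<tau> i))" if i: "i < n" for i
  proof (cases "\<sigma> i = \<tau> i")
    case True
    then show ?thesis
    proof (cases "\<tau> i \<in> E")
      case True
      then have "y (slot n \<tau> i) = x (slot n \<sigma> i)"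
        using * i \<open>\<sigma> i = \<tau> i\<close> by (simp add: transfer_slot edge_positions_def)
      then show ?thesis using \<open>\<sigma> i = \<tau> i\<close> by simp
    qed (simp add: cell_param_def)
  next
    case False
    have "cell_param (\<sigma> i) (x (slot n \<sigma> i)) = cell_param (\<sigma> i) (x0 (slot n \<sigma> i))"
      using * i False by (auto simp: cell_param_def matching_face_def edge_positions_def)
    also have "\<dots> = cell_param (\<tau> i) (y0 (slot n \<tau> i))"
      using eq i by (simp add: cube_map_eq_iff)
    also have "\<dots> = cell_param (\<tau> i) (y (slot n \<tau> i))"
    proof (cases "\<tau> i \<in> E")
      case True
      then have "i \<in> edge_positions n \<tau>" using i by (simp add: edge_positions_def)
      then have "y (slot n \<tau> i) = y0 (slot n \<tau> i)"
        using * False unfolding matching_face_def by auto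
      then show ?thesis by simp
    qed (simp add: cell_param_def)
    finally show ?thesis .
  qed
  then show "cube_map n \<sigma> x = cube_map n \<tau> y" by (simp add: cube_map_eq_iff)
qed

definition cubes :: "nat \<Rightarrow> (nat \<times> ((nat \<Rightarrow> real) \<Rightarrow> nat \<Rightarrow> 'a)) set" where
  "cubes n = (\<lambda>\<sigma>. (label_dim n \<sigma>, cube_map n \<sigma>)) ` labels n"

text \<open>
  The map is closed because each summand is compact and there are finitely many of them.
\<close>

lemma quotient_map_from_finite_sum:
  assumes "finite S" "Hausdorff_space Y"
    and "\<And>s. s \<in> S \<Longrightarrow> compact_space (X s)"
    and f: "\<And>s. s \<in> S \<Longrightarrow> continuous_map (X s) Y (f s)"
    and surj: "topspace Y \<subseteq> (\<Union>s\<in>S. f s ` topspace (X s))"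
  shows "quotient_map (sum_topology X S) Y (\<lambda>(s, x). f s x)"
proof (rule continuous_closed_imp_quotient_map)
  have im: "f s x \<in> topspace Y" if "s \<in> S" "x \<in> topspace (X s)" for s x
    using continuous_map_image_subset_topspace[OF f[OF that(1)]] that by blast
  show "continuous_map (sum_topology X S) Y (\<lambda>(s, x). f s x)"
    unfolding continuous_map_closedin
  proof (intro conjI allI impI)
    show "(\<lambda>(s, x). f s x) \<in> topspace (sum_topology X S) \<rightarrow> topspace Y" using im by auto
    fix C assume C: "closedin Y C"
    have "{x. (s, x) \<in> {z \<in> topspace (sum_topology X S). (case z of (s, x) \<Rightarrow> f s x) \<in> C}}
        = {x \<in> topspace (X s). f s x \<in> C}" if "s \<in> S" for s using that by auto
    then show "closedin (sum_topology X S) {z \<in> topspace (sum_topology X S). (case z of (s, x) \<Rightarrow> f s x) \<in> C}"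
      unfolding closedin_sum_topology
      using closedin_continuous_map_preimage[OF f C] by auto
  qed
  show "closed_map (sum_topology X S) Y (\<lambda>(s, x). f s x)"
    unfolding closed_map_def
  proof (intro allI impI)
    fix U assume U: "closedin (sum_topology X S) U"
    then have "U \<subseteq> Sigma S (topspace \<circ> X)" by (simp add: closedin_sum_topology)
    then have "(\<lambda>(s, x). f s x) ` U = (\<Union>s\<in>S. f s ` {x. (s, x) \<in> U})" by force
    moreover have "closedin Y (f s ` {x. (s, x) \<in> U})" if "s \<in> S" for s
      using continuous_imp_closed_map[OF f[OF that] assms(3)[OF that] assms(2)] U that
      unfolding closedin_sum_topology closed_map_def by blast
    ultimately show "closedin Y ((\<lambda>(s, x). f s x) ` U)"
      using assms(1) by (auto intro!: closedin_Union)
  qed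
  show "(\<lambda>(s, x). f s x) ` topspace (sum_topology X S) = topspace Y"
    using surj im by (fastforce simp: image_iff)
qed

lemma cube_gluing_cubes:
  assumes contr: "contractible_space G"
  shows "cube_gluing (uncrowded_conf n) (cubes n)"
  unfolding cube_gluing_def
proof (intro conjI)
  have "quotient_map (sum_topology (\<lambda>s. unit_cube (fst s)) (cubes n)) (uncrowded_conf n) (\<lambda>(s, x). snd s x)"
  proof (rule quotient_map_from_finite_sum)
    show "finite (cubes n)" by (simp add: cubes_def finite_labels)
    show "continuous_map (unit_cube (fst s)) (uncrowded_conf n) (snd s)" if "s \<in> cubes n" for s
      using that continuous_cube_map by (auto simp: cubes_def)
    show "topspace (uncrowded_conf n) \<subseteq> (\<Union>s\<in>cubes n. snd s ` topspace (unit_cube (fst s)))"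
    proof
      fix z assume "z \<in> topspace (uncrowded_conf n)"
      then obtain \<sigma> where \<sigma>: "\<sigma> \<in> labels n" "z \<in> PiE {..<n} \<sigma>"
        using uncrowded_mem_product_cell by (auto simp: topspace_uncrowded_conf)
      then obtain x where "x \<in> topspace (cube_of n \<sigma>)" "z = cube_map n \<sigma> x"
      proof -
        have "z \<in> cube_map n \<sigma> ` open_face (label_dim n \<sigma>) {} {}"
          using \<sigma> cube_map_open_cube by blast
        then show ?thesis using that by (auto simp: mem_open_face_empty)
      qed
      then show "z \<in> (\<Union>s\<in>cubes n. snd s ` topspace (unit_cube (fst s)))"
        using \<sigma>(1) by (auto simp: cubes_def)
    qed
  qed (simp_all add: Hausdorff_uncrowded_conf compact_space_unit_cube)
  then show "quotient_map (sum_topology (\<lambda>(k, p). unit_cube k) (cubes n)) (uncrowded_conf n) (\<lambda>((k, p), x). p x)"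
    by (simp add: split_beta')
  have "inj_on (cube_map n \<sigma>) (topspace (cube_of n \<sigma>))" if \<sigma>: "\<sigma> \<in> labels n" for \<sigma>
  proof (rule inj_onI)
    fix x y assume x: "x \<in> topspace (cube_of n \<sigma>)" and y: "y \<in> topspace (cube_of n \<sigma>)"
      and eq: "cube_map n \<sigma> x = cube_map n \<sigma> y"
    show "x = y"
    proof (rule cube_eqI[OF x y])
      fix i assume "i \<in> edge_positions n \<sigma>"
      then have "\<sigma> i \<in> E" "\<gamma> (\<sigma> i) (x (slot n \<sigma> i)) = \<gamma> (\<sigma> i) (y (slot n \<sigma> i))"
        using eq by (auto simp: cube_map_eq_iff edge_positions_def cell_param_def)
      then show "x (slot n \<sigma> i) = y (slot n \<sigma> i)"
        using tree_edge_inj[OF contr] unit_cube_nonneg_le_1[OF x] unit_cube_nonneg_le_1[OF y] by blast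
    qed
  qed
  then show "\<forall>(k, p)\<in>cubes n. inj_on p (topspace (unit_cube k))" by (auto simp: cubes_def)
  have "\<exists>T T' h. is_face (label_dim n \<sigma>) T \<and> is_face (label_dim n \<tau>) T' \<and>
      face_isometry (label_dim n \<sigma>) T (label_dim n \<tau>) T' h \<and>
      (\<forall>x\<in>topspace (cube_of n \<sigma>). \<forall>y\<in>topspace (cube_of n \<tau>).
         cube_map n \<sigma> x = cube_map n \<tau> y \<longleftrightarrow> x \<in> T \<and> y \<in> T' \<and> y = h x)"
    if \<sigma>: "\<sigma> \<in> labels n" and \<tau>: "\<tau> \<in> labels n"
      and ne: "cube_map n \<sigma> ` topspace (cube_of n \<sigma>) \<inter> cube_map n \<tau> ` topspace (cube_of n \<tau>) \<noteq> {}" for \<sigma> \<tau>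
  proof -
    obtain x0 y0 where x0: "x0 \<in> topspace (cube_of n \<sigma>)" and y0: "y0 \<in> topspace (cube_of n \<tau>)"
      and eq: "cube_map n \<sigma> x0 = cube_map n \<tau> y0" using ne by auto
    show ?thesis
      by (intro exI[of _ "matching_face n \<sigma> \<tau> x0"] exI[of _ "matching_face n \<tau> \<sigma> y0"]
          exI[of _ "transfer n \<sigma> \<tau> y0"] conjI ballI
          is_face_matching_face[OF \<sigma> \<tau> x0 y0 eq] is_face_matching_face[OF \<tau> \<sigma> y0 x0 eq[symmetric]]
          face_isometry_transfer[OF x0 y0] tree_cube_map_eq_iff[OF contr \<sigma> \<tau> x0 y0 eq])
  qed
  then show "\<forall>(k, p)\<in>cubes n. \<forall>(l, q)\<in>cubes n.
        p ` topspace (unit_cube k) \<inter> q ` topspace (unit_cube l) \<noteq> {} \<longrightarrow>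
        (\<exists>T T' h. is_face k T \<and> is_face l T' \<and> face_isometry k T l T' h \<and>
           (\<forall>x\<in>topspace (unit_cube k). \<forall>y\<in>topspace (unit_cube l).
              p x = q y \<longleftrightarrow> x \<in> T \<and> y \<in> T' \<and> y = h x))"
    unfolding cubes_def by (simp only: ball_simps prod.case) blast
qed

lemma cube_cells_cubes: "cube_cells (cubes n) = product_cells n"
proof (intro ext equalityI subsetI)
  fix j c assume "c \<in> cube_cells (cubes n) j"
  then obtain \<sigma> A B where \<sigma>: "\<sigma> \<in> labels n" and AB: "face_index (label_dim n \<sigma>) A B"
    and c: "c = cube_map n \<sigma> ` open_face (label_dim n \<sigma>) A B" and j: "label_dim n \<sigma> = j + card (A \<union> B)"
    unfolding cube_cells_def cubes_def by blast
  have "c = PiE {..<n} (face_label n \<sigma> A B)" using cube_map_open_face[OF \<sigma> AB] c by simp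
  moreover have "label_dim n (face_label n \<sigma> A B) = j" using label_dim_face_label[OF \<sigma> AB] j by simp
  ultimately show "c \<in> product_cells n j"
    using face_label_mem[OF \<sigma>] unfolding product_cells_def by blast
next
  fix j c assume "c \<in> product_cells n j"
  then obtain \<sigma> where \<sigma>: "\<sigma> \<in> labels n" "c = PiE {..<n} \<sigma>" "label_dim n \<sigma> = j"
    by (auto simp: product_cells_def)
  have "(j, cube_map n \<sigma>) \<in> cubes n" using \<sigma> by (auto simp: cubes_def)
  moreover have "c = cube_map n \<sigma> ` open_face j {} {}" using cube_map_open_cube[OF \<sigma>(1)] \<sigma> by simp
  moreover have "face_index j {} {}" "j = j + card ({} \<union> {} :: nat set)" by (auto simp: face_index_def)
  ultimately show "c \<in> cube_cells (cubes n) j" unfolding cube_cells_def by blast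
qed

lemma cubical_complex_uncrowded_conf:
  "contractible_space G \<Longrightarrow> cubical_complex (uncrowded_conf n) (product_cells n)"
  unfolding cubical_complex_def
  using cw_complex_uncrowded_conf cube_gluing_cubes cube_cells_cubes by metis

end

theorem theorem1:
  fixes G :: "'a topology" and V :: "'a set" and E :: "'a set set" and n :: nat
  assumes "graph G V E"
  shows "\<exists>(X :: (nat \<Rightarrow> 'a) topology) K.
           cw_complex X K \<and> cw_dim_le K (card E) \<and>
           sink_conf n G V homotopy_equivalent_space X \<and>
           (tree G V E \<longrightarrow> cubical_complex X K)"
proof -
  obtain \<gamma> where "param_graph G V E \<gamma>"
    using graph_parametrization[OF assms] by blast
  then interpret param_graph G V E \<gamma> .
  show ?thesis
  proof (intro exI conjI impI)
    show "cw_complex (uncrowded_conf n) (product_cells n)" by (rule cw_complex_uncrowded_conf)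
    show "cw_dim_le (product_cells n) (card E)" by (rule cw_dim_le_product_cells)
    show "sink_conf n G V homotopy_equivalent_space uncrowded_conf n"
      unfolding uncrowded_conf_def by (rule homotopy_equivalent_uncrowded)
    show "cubical_complex (uncrowded_conf n) (product_cells n)" if "tree G V E"
      using that by (intro cubical_complex_uncrowded_conf) (simp add: tree_def)
  qed
qed

end
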